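(* (1) Let $A$ and $B$ be free groups with $A=F(X)$, $B=F(Y)$, $X,Y$ finite, and let $G=A\ast_C B$ be a free product with finitely generated amalgamated subgroup $C$. Then Algorithm II (described in the context, with its standing assumptions) has at most exponential time complexity: there is a constant $L_1$ such that the time spent by Algorithm II on an input word $w=g_1\cdots g_k$ (where the $g_i$ are non-empty reduced words alternately in $X$ and in $Y$, and $k=l(w)$ is the number of these syllables) is at most $$k\cdot L_1\cdot |w|\cdot \lambda^k\cdot(|w|+M),$$ where $|w|$ is the length of $w$ as a word in $X\cup Y$ and $\lambda, M$ are the constants described in the context. (2) There are finitely generated free groups $A$ and $B$ and a finitely generated subgroup $C$ of $A$ and $B$ such that, in the free product with amalgamation $A\ast_C B$, the time complexity of Algorithm II is precisely exponential: besides the exponential upper bound of (1), there is an exponential lower bound, i.e. there are constants $c>0$, $\alpha>1$ and input words $w$ of arbitrarily large syllable length $l(w)$ on which Algorithm II takes at least $c\,\alpha^{l(w)}$ steps.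
   Context: Setting. $C$ is given by generators $z_1,\dots,z_n$ and monomorphisms $\phi:C\to A$, $\psi:C\to B$, with $u_i=z_i^\phi$ a word in $X$ and $v_i=z_i^\psi$ a word in $Y$; $G=A\ast_C B=\langle X\cup Y\mid u_i=v_i,\ i=1,\dots,n\rangle$. We identify $A,B$ with subgroups of $G$ and $C$ with $A\cap B$. $S$ and $T$ are fixed recursive systems of right coset representatives of $C$ in $A$ and in $B$, the representative of $C$ being $1$. The normal form of $g\in G$ is the unique expression $g=cp_1\cdots p_m$ with $c\in C$, $p_i\in (S\cup T)\smallsetminus\{1\}$, and consecutive $p_i$ in different factors. Algorithm II. Subalgorithms: for the subgroup $C$ in $A$ and in $B$, an algorithm for the Membership Search Problem (decide whether a word lies in $C$ and, if so, write it as a word in the given generators $u_i$, respectively $v_i$) and for the Coset Representative Search Problem (given $w$, find the representative of $Cw$ in $S$, respectively $T$). Input: a word $g=g_1\cdots g_k$ with $g_i$ reduced words alternately in $X$ and $Y$. Step 1 (applied to a product $g_1\cdots g_i$). If $g_i$ is a word in $X$, write $g_i=c\,p$ with $p\in S$ and $c\in C$ given as a word $c(u_1,\dots,u_n)$ (this uses the subalgorithms); (a.2) rewrite $c(u_1,\dots,u_n)$ as $c(v_1,\dots,v_n)$ by substituting $v_j$ for $u_j$; replace $g_{i-1}$ by $g_{i-1}'=g_{i-1}c(v_1,\dots,v_n)$; keep $p$ as last syllable if $p\neq1$, delete it if $p=1$. If $g_i$ is a word in $Y$, do the same with $T$ in place of $S$ and the roles of the $u_j$ and $v_j$ exchanged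 (the rewriting of $c(v_1,\dots,v_n)$ as $c(u_1,\dots,u_n)$ is step (b.2)). Start by applying Step 1 to $g_1\cdots g_k$, repeating it as long as the last syllable gets deleted. Step 2. When the word has the form $g_1\cdots g_i\,p_{i+1}\cdots p_m$ with $p_{i+1}\cdots p_m$ in normal form, apply Step 1 to $g_1\cdots g_i$. If this produces $p_i\ne1$ and $p_i,p_{i+1}$ lie in the same factor, write $p_ip_{i+1}=c'p_i'$ with $c'\in C$ and $p_i'\in S$ (respectively $T$), multiply $g_{i-1}'$ on the right by $c'$ (written in the generators of $C$ in the other factor), and keep $p_i'$ if $p_i'\neq 1$, deleting it otherwise. Continue with Step 2 until a normal form $c_1p_1\cdots p_m$ is reached; output it. Let $c_j$ denote the element of $C$ (as a word) produced when the $j$-th syllable is processed; lengths $|c_j|$ are lengths as words in $X$ (respectively $Y$) after substituting the words $u_i$ (respectively $v_i$). Constants and standing assumptions (free groups). $\lambda(u,v)=\max_i|u_i|/\min_i|v_i|$, $\lambda(v,u)=\max_i|v_i|/\min_i|u_i|$ and $\lambda=\max\{\lambda(u,v),\lambda(v,u)\}$; each rewriting (a.2), (b.2) increases length by at most a factor $\lambda$. The subalgorithms satisfy: the representative $\bar w$ of a coset $Cw$ has minimal length in $Cw$; there is a constant $M$ such that if $w=c\bar w$, $c\in C$, then $|c|\le|w|+M$; the time spent on an input $w$ is at most $L|w|$ for a fixed constant $L$. It is also assumed that executing all instructions other than (a.2), (b.2) increases the length of $c_j$ by at most $M+|g_j|$, so that $|c_j|\le\lambda|c_{j+1}|+M+|g_j|$.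 *)

theory Defs
  imports Complex_Main "HOL-Algebra.Generated_Groups"
begin

section \<open>Free groups as groups of reduced words\<close>

type_synonym 'x letter = "'x \<times> bool"
type_synonym 'x word = "'x letter list"

text \<open>The letter \<open>(x, True)\<close> stands for \<open>x\<close>, and \<open>(x, False)\<close> for its inverse.\<close>

definition inv_letter :: "'x letter \<Rightarrow> 'x letter" where
  "inv_letter a = (fst a, \<not> snd a)"

definition inv_word :: "'x word \<Rightarrow> 'x word" where
  "inv_word w = rev (map inv_letter w)"

definition reduced :: "'x word \<Rightarrow> bool" where
  "reduced w \<longleftrightarrow> successively (\<lambda>a b. b \<noteq> inv_letter a) w"

definition push :: "'x letter \<Rightarrow> 'x word \<Rightarrow> 'x word" where
  "push a w = (case w of [] \<Rightarrow> [a] | b # v \<Rightarrow> if b = inv_letter a then v else a # w)"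

definition reduce :: "'x word \<Rightarrow> 'x word" where
  "reduce w = foldr push w []"

definition free_group :: "'x set \<Rightarrow> 'x word monoid" where
  "free_group X =
     \<lparr>carrier = {w. reduced w \<and> fst ` set w \<subseteq> X}, mult = (\<lambda>v w. reduce (v @ w)), one = []\<rparr>"


section \<open>Machines\<close>

text \<open>
  The subalgorithms are programs of a machine with finitely many stacks and a write-only output
  tape; a multitape Turing machine is the case where every tape is kept as the two stacks that
  meet at its head. A program is a finite partial map. From the state and the top symbols of all
  stacks (\<open>None\<close> for an empty stack) it gives the new state, for each stack the symbols that
  replace its top symbol, and the symbols appended to the output. The machine halts where the
  program is undefined. Stack symbols are input letters or auxiliary symbols \<open>Inr n\<close>.
\<close>

type_synonym ('i, 'o) prog =
  "nat \<times> ('i + nat) option list \<Rightarrow> (nat \<times> ('i + nat) list list \<times> 'o list) option"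

type_synonym ('i, 'o) config = "nat \<times> ('i + nat) list list \<times> 'o list"

record ('i, 'o) machine =
  aux_stacks :: nat
  program :: "('i, 'o) prog"
  accepting :: "nat set"

definition top_symbol :: "'s list \<Rightarrow> 's option" where
  "top_symbol s = (case s of [] \<Rightarrow> None | a # _ \<Rightarrow> Some a)"

definition start :: "('i, 'o) machine \<Rightarrow> 'i list \<Rightarrow> ('i, 'o) config" where
  "start P w = (0, map Inl w # replicate (aux_stacks P) [], [])"

fun halted :: "('i, 'o) machine \<Rightarrow> ('i, 'o) config \<Rightarrow> bool" where
  "halted P (q, ss, out) \<longleftrightarrow> program P (q, map top_symbol ss) = None"

fun next_config :: "('i, 'o) machine \<Rightarrow> ('i, 'o) config \<Rightarrow> ('i, 'o) config" where
  "next_config P (q, ss, out) =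
     (case program P (q, map top_symbol ss) of
        None \<Rightarrow> (q, ss, out)
      | Some (q', us, out') \<Rightarrow> (q', map2 (\<lambda>u s. u @ tl s) us ss, out @ out'))"

definition config_at :: "('i, 'o) machine \<Rightarrow> 'i list \<Rightarrow> nat \<Rightarrow> ('i, 'o) config" where
  "config_at P w n = (next_config P ^^ n) (start P w)"

definition halts :: "('i, 'o) machine \<Rightarrow> 'i list \<Rightarrow> bool" where
  "halts P w \<longleftrightarrow> (\<exists>n. halted P (config_at P w n))"

definition run_time :: "('i, 'o) machine \<Rightarrow> 'i list \<Rightarrow> nat" where
  "run_time P w = (LEAST n. halted P (config_at P w n))"

definition accepts :: "('i, 'o) machine \<Rightarrow> 'i list \<Rightarrow> bool" where
  "accepts P w \<longleftrightarrow> fst (config_at P w (run_time P w)) \<in> accepting P"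

definition run_output :: "('i, 'o) machine \<Rightarrow> 'i list \<Rightarrow> 'o list" where
  "run_output P w = snd (snd (config_at P w (run_time P w)))"


section \<open>Amalgamated products of free groups\<close>

datatype factor = FA | FB

fun other :: "factor \<Rightarrow> factor" where
  "other FA = FB"
| "other FB = FA"

text \<open>
  The data of \<open>A *\<^sub>C B\<close>. Families indexed by \<open>factor\<close> list the datum of \<open>A\<close> at \<open>FA\<close> and
  that of \<open>B\<close> at \<open>FB\<close>: \<open>gens\<close> is \<open>X, Y\<close>; \<open>emb\<close> is \<open>\<phi>, \<psi>\<close>; \<open>reps\<close> is \<open>S, T\<close>.
  Words in the generators \<open>z\<^sub>1, \<dots>, z\<^sub>n\<close> of \<open>C\<close> are words in the indices \<open>0, \<dots>, n - 1\<close>.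
\<close>

record ('x, 'c) amalgam =
  gens :: "factor \<Rightarrow> 'x set"
  amalgamated :: "'c monoid"
  zs :: "'c list"
  emb :: "factor \<Rightarrow> 'c \<Rightarrow> 'x word"
  reps :: "factor \<Rightarrow> 'x word set"
  mem_alg :: "factor \<Rightarrow> ('x letter, nat letter) machine"
  rep_alg :: "factor \<Rightarrow> ('x letter, 'x letter) machine"

definition fgroup :: "('x, 'c) amalgam \<Rightarrow> factor \<Rightarrow> 'x word monoid" where
  "fgroup D f = free_group (gens D f)"

definition csub :: "('x, 'c) amalgam \<Rightarrow> factor \<Rightarrow> 'x word set" where
  "csub D f = emb D f ` carrier (amalgamated D)"

text \<open>
  No \<open>z\<^sub>i\<close> is trivial, since otherwise the quotients in \<open>\<lambda>\<close> have denominator \<open>0\<close>.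
\<close>

definition amalgam_data :: "('x, 'c) amalgam \<Rightarrow> bool" where
  "amalgam_data D \<longleftrightarrow>
     finite (gens D FA) \<and> finite (gens D FB) \<and> gens D FA \<inter> gens D FB = {} \<and>
     group (amalgamated D) \<and>
     set (zs D) \<subseteq> carrier (amalgamated D) \<and> \<one>\<^bsub>amalgamated D\<^esub> \<notin> set (zs D) \<and>
     generate (amalgamated D) (set (zs D)) = carrier (amalgamated D) \<and>
     (\<forall>f. emb D f \<in> hom (amalgamated D) (fgroup D f) \<and>
          inj_on (emb D f) (carrier (amalgamated D)))"

text \<open>
  \<open>subst_word D f c\<close> is \<open>c(u\<^sub>1, \<dots>, u\<^sub>n)\<close> or \<open>c(v\<^sub>1, \<dots>, v\<^sub>n)\<close> before free reduction;
  \<open>clen D f c\<close> is the length \<open>|c|\<close> of the element of \<open>C\<close> in the free group \<open>A\<close> or \<open>B\<close>.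
\<close>

definition c_words :: "('x, 'c) amalgam \<Rightarrow> nat word set" where
  "c_words D = {c. fst ` set c \<subseteq> {..<length (zs D)}}"

definition subst_word :: "('x, 'c) amalgam \<Rightarrow> factor \<Rightarrow> nat word \<Rightarrow> 'x word" where
  "subst_word D f c =
     concat (map (\<lambda>(i, b). if b then emb D f (zs D ! i) else inv_word (emb D f (zs D ! i))) c)"

definition clen :: "('x, 'c) amalgam \<Rightarrow> factor \<Rightarrow> nat word \<Rightarrow> nat" where
  "clen D f c = length (reduce (subst_word D f c))"

text \<open>The group \<open>G = \<langle>X \<union> Y | u\<^sub>i = v\<^sub>i\<rangle>\<close>, and the image in \<open>G\<close> of a word in \<open>X \<union> Y\<close>.\<close>

definition relators :: "('x, 'c) amalgam \<Rightarrow> 'x word set" where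
  "relators D = {reduce (emb D FA z @ inv_word (emb D FB z)) | z. z \<in> set (zs D)}"

definition normal_closure :: "('a, 'b) monoid_scheme \<Rightarrow> 'a set \<Rightarrow> 'a set" where
  "normal_closure G R =
     generate G {g \<otimes>\<^bsub>G\<^esub> r \<otimes>\<^bsub>G\<^esub> inv\<^bsub>G\<^esub> g | g r. g \<in> carrier G \<and> r \<in> R}"

definition amalgamated_product :: "('x, 'c) amalgam \<Rightarrow> 'x word set monoid" where
  "amalgamated_product D =
     free_group (gens D FA \<union> gens D FB) Mod
       normal_closure (free_group (gens D FA \<union> gens D FB)) (relators D)"

definition element_of :: "('x, 'c) amalgam \<Rightarrow> 'x word \<Rightarrow> 'x word set" where
  "element_of D w =
     normal_closure (free_group (gens D FA \<union> gens D FB)) (relators D)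
       #>\<^bsub>free_group (gens D FA \<union> gens D FB)\<^esub> reduce w"


section \<open>Coset representatives, subalgorithms and constants\<close>

definition transversal :: "('x, 'c) amalgam \<Rightarrow> factor \<Rightarrow> bool" where
  "transversal D f \<longleftrightarrow>
     reps D f \<subseteq> carrier (fgroup D f) \<and> [] \<in> reps D f \<and>
     (\<forall>w\<in>carrier (fgroup D f). \<exists>!s. s \<in> reps D f \<and> s \<in> csub D f #>\<^bsub>fgroup D f\<^esub> w)"

definition solves_membership_search :: "('x, 'c) amalgam \<Rightarrow> factor \<Rightarrow> bool" where
  "solves_membership_search D f \<longleftrightarrow>
     finite (dom (program (mem_alg D f))) \<and>
     (\<forall>w\<in>carrier (fgroup D f).
        halts (mem_alg D f) w \<and>
        (accepts (mem_alg D f) w \<longleftrightarrow> w \<in> csub D f) \<and>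
        (w \<in> csub D f \<longrightarrow>
           run_output (mem_alg D f) w \<in> c_words D \<and>
           reduce (subst_word D f (run_output (mem_alg D f) w)) = w))"

definition solves_coset_rep_search :: "('x, 'c) amalgam \<Rightarrow> factor \<Rightarrow> bool" where
  "solves_coset_rep_search D f \<longleftrightarrow>
     finite (dom (program (rep_alg D f))) \<and>
     (\<forall>w\<in>carrier (fgroup D f).
        halts (rep_alg D f) w \<and>
        run_output (rep_alg D f) w \<in> reps D f \<and>
        run_output (rep_alg D f) w \<in> csub D f #>\<^bsub>fgroup D f\<^esub> w)"

text \<open>\<open>gen_ratio D FA FB\<close> is \<open>\<lambda>(u,v)\<close>. For \<open>n = 0\<close>, where it is undefined, \<open>\<lambda>\<close> is taken to be \<open>1\<close>.\<close>

definition gen_ratio :: "('x, 'c) amalgam \<Rightarrow> factor \<Rightarrow> factor \<Rightarrow> real" where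
  "gen_ratio D f f' =
     real (Max ((\<lambda>z. length (emb D f z)) ` set (zs D))) /
     real (Min ((\<lambda>z. length (emb D f' z)) ` set (zs D)))"

definition lam :: "('x, 'c) amalgam \<Rightarrow> real" where
  "lam D = (if zs D = [] then 1 else max (gen_ratio D FA FB) (gen_ratio D FB FA))"


section \<open>Algorithm II\<close>

type_synonym 'x syllable = "factor \<times> 'x word"

definition alternating :: "'x syllable list \<Rightarrow> bool" where
  "alternating w \<longleftrightarrow> successively (\<lambda>s t. fst s \<noteq> fst t) w"

definition input_word :: "('x, 'c) amalgam \<Rightarrow> 'x syllable list \<Rightarrow> bool" where
  "input_word D w \<longleftrightarrow>
     w \<noteq> [] \<and> alternating w \<and> (\<forall>(f, g)\<in>set w. g \<noteq> [] \<and> g \<in> carrier (fgroup D f))"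

definition total_length :: "'x syllable list \<Rightarrow> nat" where
  "total_length w = (\<Sum>(f, g)\<leftarrow>w. length g)"

text \<open>
  Write \<open>h = c p\<close> with \<open>p\<close> a coset representative: Coset Representative Search on \<open>h\<close>, then
  Membership Search on \<open>h p\<inverse>\<close>. A product of two words costs the sum of their lengths.
\<close>

definition split_rep :: "('x, 'c) amalgam \<Rightarrow> factor \<Rightarrow> 'x word \<Rightarrow> 'x word" where
  "split_rep D f h = run_output (rep_alg D f) h"

definition split_c_input :: "('x, 'c) amalgam \<Rightarrow> factor \<Rightarrow> 'x word \<Rightarrow> 'x word" where
  "split_c_input D f h = reduce (h @ inv_word (split_rep D f h))"

definition split_c :: "('x, 'c) amalgam \<Rightarrow> factor \<Rightarrow> 'x word \<Rightarrow> nat word" where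
  "split_c D f h = run_output (mem_alg D f) (split_c_input D f h)"

definition split_time :: "('x, 'c) amalgam \<Rightarrow> factor \<Rightarrow> 'x word \<Rightarrow> nat" where
  "split_time D f h =
     run_time (rep_alg D f) h + (length h + length (split_rep D f h)) +
     run_time (mem_alg D f) (split_c_input D f h)"

text \<open>
  One pass of Step 1 or Step 2. A state \<open>(c, ps)\<close> stands for a word
  \<open>g\<^sub>1 \<dots> g\<^sub>i c p\<^sub>i\<^sub>+\<^sub>1 \<dots> p\<^sub>m\<close> in which \<open>c\<close>, a word in the generators of \<open>C\<close>, has still to
  be rewritten in the generators of the factor of \<open>g\<^sub>i\<close> (instructions (a.2), (b.2)) and multiplied
  into \<open>g\<^sub>i\<close>. Repeating Step 1 while the last syllable is deleted is the case \<open>ps = []\<close>.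
\<close>

definition absorb :: "('x, 'c) amalgam \<Rightarrow> 'x syllable \<Rightarrow> nat word \<Rightarrow> 'x word" where
  "absorb D s c = reduce (snd s @ subst_word D (fst s) c)"

definition step ::
  "('x, 'c) amalgam \<Rightarrow> 'x syllable \<Rightarrow> nat word \<times> 'x syllable list \<Rightarrow> nat word \<times> 'x syllable list"
where
  "step D s st =
     (let f = fst s; ps = snd st; h = absorb D s (fst st);
          c = split_c D f h; p = split_rep D f h
      in if p = [] then (c, ps)
         else if ps = [] \<or> fst (hd ps) \<noteq> f then (c, (f, p) # ps)
         else (let h' = reduce (p @ snd (hd ps));
                   c' = split_c D f h'; p' = split_rep D f h'
               in (c @ c', if p' = [] then tl ps else (f, p') # tl ps)))"

text \<open>
  The cost of a pass: the letters written by (a.2) or (b.2), the multiplication into the syllable,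
  the subalgorithm calls and, if it takes place, the merging with the adjacent representative;
  one further unit covers the tests and deletions.
\<close>

definition step_time ::
  "('x, 'c) amalgam \<Rightarrow> 'x syllable \<Rightarrow> nat word \<times> 'x syllable list \<Rightarrow> nat"
where
  "step_time D s st =
     (let f = fst s; ps = snd st; h = absorb D s (fst st); p = split_rep D f h;
          r = length (subst_word D f (fst st))
      in 1 + r + (length (snd s) + r) + split_time D f h +
         (if p = [] \<or> ps = [] \<or> fst (hd ps) \<noteq> f then 0
          else length p + length (snd (hd ps)) +
               split_time D f (reduce (p @ snd (hd ps)))))"

definition algorithm_II ::
  "('x, 'c) amalgam \<Rightarrow> 'x syllable list \<Rightarrow> nat word \<times> 'x syllable list"
where
  "algorithm_II D w = foldr (step D) w ([], [])"

fun time_II :: "('x, 'c) amalgam \<Rightarrow> 'x syllable list \<Rightarrow> nat" where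
  "time_II D [] = 0"
| "time_II D (s # w) = time_II D w + step_time D s (algorithm_II D w)"

text \<open>
  For \<open>w = g\<^sub>j \<dots> g\<^sub>k\<close> the first component of \<open>algorithm_II D w\<close> is \<open>c\<^sub>j\<close>. As suffixes of input
  words are input words, the last condition bounds \<open>|c\<^sub>j|\<close> for every \<open>j\<close>; \<open>|c\<^sub>j\<^sub>+\<^sub>1|\<close> occurs in
  it as it is after the rewriting.
\<close>

definition standing_assumptions :: "('x, 'c) amalgam \<Rightarrow> real \<Rightarrow> real \<Rightarrow> bool" where
  "standing_assumptions D L M \<longleftrightarrow>
     amalgam_data D \<and>
     (\<forall>f. transversal D f \<and> solves_membership_search D f \<and> solves_coset_rep_search D f \<and>
       (\<forall>s\<in>reps D f. \<forall>w\<in>csub D f #>\<^bsub>fgroup D f\<^esub> s. length s \<le> length w) \<and>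
       (\<forall>c\<in>csub D f. \<forall>s\<in>reps D f.
          real (length c) \<le> real (length (c \<otimes>\<^bsub>fgroup D f\<^esub> s)) + M) \<and>
       (\<forall>w\<in>carrier (fgroup D f).
          real (run_time (mem_alg D f) w) \<le> L * real (length w) \<and>
          real (run_time (rep_alg D f) w) \<le> L * real (length w)) \<and>
       (\<forall>c\<in>c_words D. real (clen D (other f) c) \<le> lam D * real (clen D f c))) \<and>
     (\<forall>f g w. input_word D ((f, g) # w) \<longrightarrow>
        real (clen D f (fst (algorithm_II D ((f, g) # w)))) \<le>
          real (clen D f (fst (algorithm_II D w))) + M + real (length g))"


section \<open>Algorithm II computes normal forms\<close>

text \<open>
  The output \<open>(c, ps)\<close> is a normal form of the element of \<open>G\<close> given by the input word.
\<close>

abbreviation letters :: "('x, 'c) amalgam \<Rightarrow> 'x set" where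
  "letters D \<equiv> gens D FA \<union> gens D FB"

definition normal_form :: "('x, 'c) amalgam \<Rightarrow> nat word \<times> 'x syllable list \<Rightarrow> bool" where
  "normal_form D st \<longleftrightarrow>
     fst st \<in> c_words D \<and> alternating (snd st) \<and>
     (\<forall>(f, p)\<in>set (snd st). p \<in> reps D f \<and> p \<noteq> [])"

definition state_word :: "('x, 'c) amalgam \<Rightarrow> nat word \<times> 'x syllable list \<Rightarrow> factor \<Rightarrow> 'x word" where
  "state_word D st f = subst_word D f (fst st) @ concat (map snd (snd st))"

lemma inv_letter_simps [simp]:
  "inv_letter (inv_letter a) = a" "inv_letter a \<noteq> a" "a \<noteq> inv_letter a"
  "fst (inv_letter a) = fst a"
  by (auto simp: inv_letter_def prod_eq_iff)

lemma inv_letter_eq_iff: "inv_letter a = b \<longleftrightarrow> a = inv_letter b"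
  by auto

lemma reduced_simps [simp]:
  "reduced []"
  "reduced (a # w) \<longleftrightarrow> w = [] \<or> (hd w \<noteq> inv_letter a \<and> reduced w)"
  by (auto simp: reduced_def successively_Cons)

lemma reduced_push: "reduced w \<Longrightarrow> reduced (push a w)"
  by (cases w) (auto simp: push_def)

lemma push_inv_push: "reduced w \<Longrightarrow> push a (push (inv_letter a) w) = w"
  by (cases w; cases "tl w") (auto simp: push_def)

lemma reduced_foldr_push: "reduced r \<Longrightarrow> reduced (foldr push w r)"
  by (induction w) (auto intro: reduced_push)

lemma reduced_reduce [simp]: "reduced (reduce w)"
  by (simp add: reduce_def reduced_foldr_push)

lemma foldr_push_push: "reduced r \<Longrightarrow> foldr push (push a w) r = push a (foldr push w r)"
proof (cases w)
  case (Cons b v)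
  assume r: "reduced r"
  show ?thesis
  proof (cases "b = inv_letter a")
    case True
    then show ?thesis
      using Cons push_inv_push[OF reduced_foldr_push[OF r, of v], of a] by (simp add: push_def)
  next
    case False
    then show ?thesis using Cons by (simp add: push_def)
  qed
qed (simp add: push_def)

lemma foldr_push_reduce: "reduced r \<Longrightarrow> foldr push (reduce w) r = foldr push w r"
  by (induction w) (auto simp: reduce_def foldr_push_push)

lemma reduce_append: "reduce (v @ w) = foldr push v (reduce w)"
  by (simp add: reduce_def)

lemma reduce_reduced: "reduced w \<Longrightarrow> reduce w = w"
  by (induction w) (auto simp: reduce_def push_def split: list.splits)

lemma reduce_append_reduce [simp]:
  "reduce (reduce v @ w) = reduce (v @ w)" "reduce (v @ reduce w) = reduce (v @ w)"
  by (simp_all add: reduce_append foldr_push_reduce reduce_reduced)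

lemma reduce_Nil [simp]: "reduce [] = []"
  by (simp add: reduce_def)

lemma set_push: "set (push a w) \<subseteq> insert a (set w)"
  by (auto simp: push_def split: list.splits if_splits)

lemma set_reduce: "set (reduce w) \<subseteq> set w"
proof (induction w)
  case (Cons a w)
  then show ?case using set_push[of a "reduce w"] by (auto simp: reduce_def)
qed simp

lemma inv_word_simps [simp]:
  "inv_word [] = []" "inv_word (v @ w) = inv_word w @ inv_word v" "inv_word (inv_word w) = w"
  "fst ` set (inv_word w) = fst ` set w"
  by (auto simp: inv_word_def rev_map o_def image_image)

lemma inv_word_Cons: "inv_word (a # w) = inv_word w @ [inv_letter a]"
  by (simp add: inv_word_def)

lemma reduce_cancel: "reduce (v @ a # inv_letter a # w) = reduce (v @ w)"
  using push_inv_push[of "reduce w" a] by (simp add: reduce_append) (simp add: reduce_def)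

lemma reduce_inv_left: "reduce (inv_word w @ w) = []"
proof (induction w)
  case (Cons a w)
  then show ?case
    using reduce_cancel[of "inv_word w" "inv_letter a" w] by (simp add: inv_word_Cons)
qed simp

lemma reduce_inv_right: "reduce (w @ inv_word w) = []"
  using reduce_inv_left[of "inv_word w"] by simp

lemma reduced_inv_word: "reduced w \<Longrightarrow> reduced (inv_word w)"
proof (induction w)
  case (Cons a w)
  then show ?case
    by (cases w) (auto simp: reduced_def inv_word_def successively_append_iff)
qed simp

lemma free_group_simps [simp]:
  "w \<in> carrier (free_group X) \<longleftrightarrow> reduced w \<and> fst ` set w \<subseteq> X"
  "v \<otimes>\<^bsub>free_group X\<^esub> w = reduce (v @ w)"
  "\<one>\<^bsub>free_group X\<^esub> = []"
  by (auto simp: free_group_def)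

lemma fst_set_reduce: "fst ` set w \<subseteq> X \<Longrightarrow> fst ` set (reduce w) \<subseteq> X"
  using set_reduce by fastforce

lemma group_free_group: "group (free_group X)"
proof (rule groupI)
  fix x y assume "x \<in> carrier (free_group X)" "y \<in> carrier (free_group X)"
  then show "x \<otimes>\<^bsub>free_group X\<^esub> y \<in> carrier (free_group X)"
    using fst_set_reduce[of "x @ y" X] by (auto simp: image_Un)
next
  fix x assume x: "x \<in> carrier (free_group X)"
  then show "\<exists>y\<in>carrier (free_group X). y \<otimes>\<^bsub>free_group X\<^esub> x = \<one>\<^bsub>free_group X\<^esub>"
    using reduced_inv_word[of x] reduce_inv_left[of x]
    by (intro bexI[of _ "inv_word x"]) auto
qed (auto simp: reduce_reduced)

lemma inv_free_group:
  "w \<in> carrier (free_group X) \<Longrightarrow> inv\<^bsub>free_group X\<^esub> w = inv_word w"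
  by (rule group.inv_equality[OF group_free_group])
    (auto simp: reduced_inv_word reduce_inv_left)

lemma normal_closure_normal:
  assumes "group G" "R \<subseteq> carrier G"
  shows "normal_closure G R \<lhd> G"
proof -
  interpret group G by fact
  show ?thesis
    unfolding normal_closure_def
  proof (rule normal_generateI)
    show "{g \<otimes>\<^bsub>G\<^esub> r \<otimes>\<^bsub>G\<^esub> inv\<^bsub>G\<^esub> g |g r. g \<in> carrier G \<and> r \<in> R} \<subseteq> carrier G"
      using assms by auto
  next
    fix h g assume "h \<in> {g \<otimes>\<^bsub>G\<^esub> r \<otimes>\<^bsub>G\<^esub> inv\<^bsub>G\<^esub> g |g r. g \<in> carrier G \<and> r \<in> R}" and g: "g \<in> carrier G"
    then obtain k r where h: "h = k \<otimes>\<^bsub>G\<^esub> r \<otimes>\<^bsub>G\<^esub> inv\<^bsub>G\<^esub> k" "k \<in> carrier G" "r \<in> R" by auto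
    then have "g \<otimes>\<^bsub>G\<^esub> h \<otimes>\<^bsub>G\<^esub> inv\<^bsub>G\<^esub> g = (g \<otimes>\<^bsub>G\<^esub> k) \<otimes>\<^bsub>G\<^esub> r \<otimes>\<^bsub>G\<^esub> inv\<^bsub>G\<^esub> (g \<otimes>\<^bsub>G\<^esub> k)"
      using g assms(2) by (auto simp: inv_mult_group m_assoc subset_iff)
    then show "g \<otimes>\<^bsub>G\<^esub> h \<otimes>\<^bsub>G\<^esub> inv\<^bsub>G\<^esub> g \<in> {g \<otimes>\<^bsub>G\<^esub> r \<otimes>\<^bsub>G\<^esub> inv\<^bsub>G\<^esub> g |g r. g \<in> carrier G \<and> r \<in> R}"
      using g h by auto
  qed
qed

lemma gens_letters: "gens D f \<subseteq> letters D"
  by (cases f) auto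

lemma emb_carrier:
  assumes "amalgam_data D" "z \<in> set (zs D)"
  shows "reduced (emb D f z)" "fst ` set (emb D f z) \<subseteq> gens D f"
proof -
  have "z \<in> carrier (amalgamated D)" "emb D f \<in> hom (amalgamated D) (free_group (gens D f))"
    using assms by (auto simp: amalgam_data_def fgroup_def)
  then have "emb D f z \<in> carrier (free_group (gens D f))" by (simp add: hom_def Pi_iff del: free_group_simps)
  then show "reduced (emb D f z)" "fst ` set (emb D f z) \<subseteq> gens D f" by auto
qed

lemma subst_word_Cons:
  "subst_word D f (a # c) =
     (if snd a then emb D f (zs D ! fst a) else inv_word (emb D f (zs D ! fst a))) @ subst_word D f c"
  by (cases a) (simp add: subst_word_def)

lemma subst_word_append: "subst_word D f (b @ c) = subst_word D f b @ subst_word D f c"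
  by (simp add: subst_word_def)

lemma subst_word_letters:
  assumes "amalgam_data D" "c \<in> c_words D"
  shows "fst ` set (subst_word D f c) \<subseteq> gens D f"
  using assms(2)
proof (induction c)
  case (Cons a c)
  then have "zs D ! fst a \<in> set (zs D)" "c \<in> c_words D" by (auto simp: c_words_def)
  then show ?case
    using Cons.IH emb_carrier(2)[OF assms(1), of "zs D ! fst a" f]
    by (simp add: subst_word_Cons image_Un)
qed (simp add: subst_word_def)

lemma relators_carrier:
  assumes "amalgam_data D"
  shows "relators D \<subseteq> carrier (free_group (letters D))"
proof
  fix r assume "r \<in> relators D"
  then obtain z where z: "z \<in> set (zs D)" "r = reduce (emb D FA z @ inv_word (emb D FB z))"
    by (auto simp: relators_def)
  have "fst ` set (emb D FA z @ inv_word (emb D FB z)) \<subseteq> letters D"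
    using emb_carrier(2)[OF assms z(1), of FA] emb_carrier(2)[OF assms z(1), of FB]
    by (simp add: image_Un le_supI1 le_supI2)
  then show "r \<in> carrier (free_group (letters D))"
    using fst_set_reduce[of "emb D FA z @ inv_word (emb D FB z)" "letters D"] z(2) by simp
qed

lemma group_amalgamated_product:
  assumes "amalgam_data D"
  shows "group (amalgamated_product D)"
  unfolding amalgamated_product_def
  by (intro normal.factorgroup_is_group normal_closure_normal group_free_group
      relators_carrier assms)

lemma element_of_reduce: "element_of D (reduce w) = element_of D w"
  by (simp add: element_of_def reduce_reduced)

lemma element_of_hom:
  assumes "amalgam_data D"
  shows "group_hom (free_group (letters D)) (amalgamated_product D) (element_of D)"
proof (rule group_hom.intro[OF group_free_group group_amalgamated_product[OF assms]],
    unfold_locales)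
  interpret normal "normal_closure (free_group (letters D)) (relators D)" "free_group (letters D)"
    by (intro normal_closure_normal group_free_group relators_carrier assms)
  show "element_of D \<in> hom (free_group (letters D)) (amalgamated_product D)"
    using r_coset_hom_Mod unfolding amalgamated_product_def element_of_def hom_def
    by (auto simp: Pi_iff reduce_reduced)
qed

lemma element_of_append:
  assumes "amalgam_data D" "fst ` set v \<subseteq> letters D" "fst ` set w \<subseteq> letters D"
  shows "element_of D (v @ w) =
           element_of D v \<otimes>\<^bsub>amalgamated_product D\<^esub> element_of D w"
  using group_hom.hom_mult[OF element_of_hom[OF assms(1)], of "reduce v" "reduce w"]
    fst_set_reduce[OF assms(2)] fst_set_reduce[OF assms(3)]
  by (simp add: element_of_reduce)

lemma element_of_emb:
  assumes "amalgam_data D" "z \<in> set (zs D)"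
  shows "element_of D (emb D FA z) = element_of D (emb D FB z)"
proof -
  let ?F = "free_group (letters D)" and ?N = "normal_closure (free_group (letters D)) (relators D)"
  interpret normal ?N ?F
    by (intro normal_closure_normal group_free_group relators_carrier assms)
  have ab: "emb D FA z \<in> carrier ?F" "emb D FB z \<in> carrier ?F"
    using emb_carrier[OF assms, of FA] emb_carrier[OF assms, of FB] by auto
  let ?r = "reduce (emb D FA z @ inv_word (emb D FB z))"
  have r: "?r \<in> relators D" using assms(2) by (auto simp: relators_def)
  then have "?r \<in> carrier ?F" using relators_carrier[OF assms(1)] by blast
  then have "?r \<in> ?N"
    using r unfolding normal_closure_def
    by (intro generate.incl CollectI exI[of _ "[]"] exI[of _ ?r])
      (simp add: inv_free_group reduce_reduced)
  then have "emb D FA z \<otimes>\<^bsub>?F\<^esub> inv\<^bsub>?F\<^esub> emb D FB z \<in> ?N"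
    using inv_free_group[OF ab(2)] by simp
  moreover have "emb D FA z =
      (emb D FA z \<otimes>\<^bsub>?F\<^esub> inv\<^bsub>?F\<^esub> emb D FB z) \<otimes>\<^bsub>?F\<^esub> emb D FB z"
    using ab by (simp add: m_assoc del: free_group_simps)
  ultimately have "emb D FA z \<in> ?N #>\<^bsub>?F\<^esub> emb D FB z"
    unfolding r_coset_def by blast
  then have "?N #>\<^bsub>?F\<^esub> emb D FB z = ?N #>\<^bsub>?F\<^esub> emb D FA z"
    using ab by (intro repr_independence is_subgroup)
  then show ?thesis
    using ab by (simp add: element_of_def reduce_reduced)
qed

lemma element_of_subst_word:
  assumes D: "amalgam_data D" and c: "c \<in> c_words D"
  shows "element_of D (subst_word D FA c) = element_of D (subst_word D FB c)"
  using c
proof (induction c)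
  case (Cons a c)
  let ?z = "zs D ! fst a"
  let ?w = "\<lambda>f. if snd a then emb D f ?z else inv_word (emb D f ?z)"
  interpret H: group_hom "free_group (letters D)" "amalgamated_product D" "element_of D"
    by (rule element_of_hom[OF D])
  have z: "?z \<in> set (zs D)" and c: "c \<in> c_words D"
    using Cons.prems by (auto simp: c_words_def)
  have car: "emb D f ?z \<in> carrier (free_group (letters D))" for f
    using emb_carrier[OF D z, of f] gens_letters[of D f] by auto
  have "element_of D (inv_word (emb D f ?z)) =
          inv\<^bsub>amalgamated_product D\<^esub> element_of D (emb D f ?z)" for f
    using H.hom_inv[OF car[of f]] by (simp only: inv_free_group[OF car])
  then have w: "element_of D (?w FA) = element_of D (?w FB)"
    using element_of_emb[OF D z] by simp
  have "element_of D (subst_word D f (a # c)) =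
          element_of D (?w f) \<otimes>\<^bsub>amalgamated_product D\<^esub> element_of D (subst_word D f c)" for f
    unfolding subst_word_Cons
    using subst_word_letters[OF D c, of f] gens_letters[of D f] car[of f]
    by (intro element_of_append[OF D]) (auto simp: subset_iff)
  then show ?case using w Cons.IH[OF c] by simp
qed (simp add: subst_word_def)

lemma csub_subgroup:
  assumes "amalgam_data D"
  shows "subgroup (csub D f) (fgroup D f)"
proof -
  interpret group_hom "amalgamated D" "fgroup D f" "emb D f"
    using assms group_free_group
    by (auto simp: amalgam_data_def fgroup_def group_hom_def group_hom_axioms_def)
  show ?thesis unfolding csub_def by (rule img_is_subgroup)
qed

lemma split_correct:
  assumes D: "amalgam_data D" "transversal D f"
    "solves_membership_search D f" "solves_coset_rep_search D f"
    and h: "h \<in> carrier (fgroup D f)"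
  shows "split_rep D f h \<in> reps D f" "split_c D f h \<in> c_words D"
    "reduce (subst_word D f (split_c D f h) @ split_rep D f h) = h"
proof -
  interpret group "fgroup D f" by (simp add: fgroup_def group_free_group)
  let ?p = "split_rep D f h"
  show p: "?p \<in> reps D f"
    using D h by (simp add: split_rep_def solves_coset_rep_search_def)
  then have pc: "?p \<in> carrier (fgroup D f)" using D by (auto simp: transversal_def)
  have "?p \<in> csub D f #>\<^bsub>fgroup D f\<^esub> h"
    using D h by (simp add: split_rep_def solves_coset_rep_search_def)
  then obtain c where c: "c \<in> csub D f" "?p = c \<otimes>\<^bsub>fgroup D f\<^esub> h"
    by (auto simp: r_coset_def)
  have cc: "c \<in> carrier (fgroup D f)"
    using c(1) subgroup.subset[OF csub_subgroup[OF D(1)]] by blast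
  have "h \<otimes>\<^bsub>fgroup D f\<^esub> inv\<^bsub>fgroup D f\<^esub> ?p = inv\<^bsub>fgroup D f\<^esub> c"
    using cc h c(2) by (simp add: inv_mult_group m_assoc[symmetric])
  then have "h \<otimes>\<^bsub>fgroup D f\<^esub> inv\<^bsub>fgroup D f\<^esub> ?p \<in> csub D f"
    using c(1) subgroup.m_inv_closed[OF csub_subgroup[OF D(1)]] by simp
  moreover have "h \<otimes>\<^bsub>fgroup D f\<^esub> inv\<^bsub>fgroup D f\<^esub> ?p = split_c_input D f h"
    using pc unfolding fgroup_def by (simp add: inv_free_group split_c_input_def)
  ultimately have m: "split_c_input D f h \<in> csub D f" by simp
  then have mc: "split_c_input D f h \<in> carrier (fgroup D f)"
    using subgroup.subset[OF csub_subgroup[OF D(1)]] by blast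
  show "split_c D f h \<in> c_words D"
    using D m mc by (simp add: split_c_def solves_membership_search_def)
  have "reduce (subst_word D f (split_c D f h)) = split_c_input D f h"
    using D m mc by (simp add: split_c_def solves_membership_search_def)
  then have "reduce (subst_word D f (split_c D f h) @ ?p) = reduce (split_c_input D f h @ ?p)"
    by (metis reduce_append_reduce(1))
  also have "\<dots> = reduce (h @ inv_word ?p @ ?p)"
    by (simp add: split_c_input_def)
  also have "\<dots> = reduce (h @ reduce (inv_word ?p @ ?p))"
    by (rule reduce_append_reduce(2)[symmetric])
  also have "\<dots> = h"
    using h by (simp add: reduce_inv_left reduce_reduced fgroup_def)
  finally show "reduce (subst_word D f (split_c D f h) @ ?p) = h" .
qed

lemma alternating_simps [simp]:
  "alternating []"
  "alternating (s # w) \<longleftrightarrow> w = [] \<or> (fst s \<noteq> fst (hd w) \<and> alternating w)"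
  by (auto simp: alternating_def successively_Cons)

lemma reduce_cong_left: "reduce v = reduce v' \<Longrightarrow> reduce (v @ w) = reduce (v' @ w)"
  by (metis reduce_append_reduce(1))

lemma reduce_cong_right: "reduce w = reduce w' \<Longrightarrow> reduce (v @ w) = reduce (v @ w')"
  by (metis reduce_append_reduce(2))

lemma step_correct:
  assumes D: "amalgam_data D" "\<And>f. transversal D f"
    "\<And>f. solves_membership_search D f" "\<And>f. solves_coset_rep_search D f"
    and s: "snd s \<in> carrier (fgroup D (fst s))" and st: "normal_form D st"
  shows "normal_form D (step D s st)"
    "reduce (state_word D (step D s st) (fst s)) = reduce (snd s @ state_word D st (fst s))"
proof -
  obtain f g c ps where sf: "s = (f, g)" "st = (c, ps)" by (cases s, cases st) auto
  define h p c1 where "h = absorb D s c" and "p = split_rep D f h" and "c1 = split_c D f h"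
  have c: "c \<in> c_words D" and alt: "alternating ps"
    and ps: "\<And>f p. (f, p) \<in> set ps \<Longrightarrow> p \<in> reps D f \<and> p \<noteq> []"
    using st by (auto simp: normal_form_def sf)
  have "fst ` set (g @ subst_word D f c) \<subseteq> gens D f"
    using s subst_word_letters[OF D(1) c, of f] by (simp add: sf fgroup_def image_Un)
  then have hc: "h \<in> carrier (fgroup D f)"
    using fst_set_reduce[of "g @ subst_word D f c" "gens D f"]
    by (simp add: h_def absorb_def sf fgroup_def)
  note 1 = split_correct[OF D(1) D(2-4) hc, folded p_def c1_def]
  have goal: "reduce (snd s @ state_word D st (fst s)) =
        reduce (subst_word D f c1 @ p @ concat (map snd ps))"
  proof -
    have "reduce (snd s @ state_word D st (fst s)) = reduce (h @ concat (map snd ps))"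
      by (simp add: sf state_word_def h_def absorb_def)
    also have "\<dots> = reduce ((subst_word D f c1 @ p) @ concat (map snd ps))"
      using 1(3) hc by (intro reduce_cong_left) (simp add: fgroup_def reduce_reduced)
    finally show ?thesis by simp
  qed
  consider "p = []" | "p \<noteq> []" "ps = [] \<or> fst (hd ps) \<noteq> f"
    | p1 qs where "p \<noteq> []" "ps = (f, p1) # qs"
    by (cases ps) force+
  then have "normal_form D (step D s st) \<and>
    reduce (state_word D (step D s st) (fst s)) = reduce (subst_word D f c1 @ p @ concat (map snd ps))"
  proof cases
    case 1
    then have "step D s st = (c1, ps)"
      by (simp add: step_def Let_def sf flip: h_def[unfolded sf] p_def c1_def)
    then show ?thesis
      using 1 \<open>c1 \<in> c_words D\<close> st by (simp add: normal_form_def sf state_word_def)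
  next
    case 2
    then have "step D s st = (c1, (f, p) # ps)"
      by (auto simp: step_def Let_def sf simp flip: h_def[unfolded sf] p_def c1_def)
    then show ?thesis
      using 1 2 st by (auto simp: normal_form_def sf state_word_def)
  next
    case 3
    define h' p' c' where "h' = reduce (p @ p1)" and "p' = split_rep D f h'" and "c' = split_c D f h'"
    have st': "step D s st = (c1 @ c', if p' = [] then qs else (f, p') # qs)"
      using 3 by (simp add: step_def Let_def sf h'_def p'_def c'_def
          flip: h_def[unfolded sf] p_def c1_def)
    have "p \<in> carrier (fgroup D f)" "p1 \<in> carrier (fgroup D f)"
      using 1(1) ps[of f p1] 3 D(2)[of f] by (auto simp: transversal_def)
    then have h'c: "h' \<in> carrier (fgroup D f)"
      using fst_set_reduce[of "p @ p1" "gens D f"] by (auto simp: h'_def fgroup_def image_Un)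
    note 2 = split_correct[OF D(1) D(2-4) h'c, folded p'_def c'_def]
    have "reduce (subst_word D f (c1 @ c') @ p' @ concat (map snd qs)) =
        reduce (subst_word D f c1 @ (subst_word D f c' @ p') @ concat (map snd qs))"
      by (simp add: subst_word_append)
    also have "\<dots> = reduce (subst_word D f c1 @ (p @ p1) @ concat (map snd qs))"
      using 2(3) by (intro reduce_cong_right reduce_cong_left) (simp add: h'_def)
    finally have "reduce (subst_word D f (c1 @ c') @ p' @ concat (map snd qs)) =
        reduce (subst_word D f c1 @ p @ concat (map snd ps))"
      using 3 by simp
    moreover have "c1 @ c' \<in> c_words D" using 1(2) 2(2) by (auto simp: c_words_def)
    moreover have "alternating qs" "qs = [] \<or> f \<noteq> fst (hd qs)" using alt 3 by auto
    ultimately show ?thesis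
      using st' 2(1) 3 ps by (auto simp: normal_form_def state_word_def sf(1))
  qed
  then show "normal_form D (step D s st)"
    "reduce (state_word D (step D s st) (fst s)) = reduce (snd s @ state_word D st (fst s))"
    using goal by auto
qed

theorem algorithm_II_correct:
  assumes D: "amalgam_data D" "\<And>f. transversal D f"
    "\<And>f. solves_membership_search D f" "\<And>f. solves_coset_rep_search D f"
    and w: "\<forall>(f, g)\<in>set w. g \<in> carrier (fgroup D f)"
  shows "normal_form D (algorithm_II D w)"
    "element_of D (state_word D (algorithm_II D w) f) = element_of D (concat (map snd w))"
proof -
  have "normal_form D (algorithm_II D w) \<and>
    (\<forall>f. element_of D (state_word D (algorithm_II D w) f) = element_of D (concat (map snd w)))"
    using w
  proof (induction w)
    case Nil
    then show ?case
      by (simp add: algorithm_II_def normal_form_def c_words_def state_word_def subst_word_def)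
  next
    case (Cons s w)
    define st where "st = algorithm_II D w"
    have st: "normal_form D st"
      and eq: "\<And>f. element_of D (state_word D st f) = element_of D (concat (map snd w))"
      using Cons by (auto simp: st_def)
    have s: "snd s \<in> carrier (fgroup D (fst s))" using Cons.prems by (cases s) auto
    have letters: "fst ` set (state_word D st' f) \<subseteq> letters D" if "normal_form D st'" for st' f
    proof -
      have "fst ` set p \<subseteq> letters D" if "(f, p) \<in> set (snd st')" for f p
        using that \<open>normal_form D st'\<close> D(2)[of f] gens_letters[of D f]
        by (fastforce simp: normal_form_def transversal_def fgroup_def)
      moreover have "fst ` set (subst_word D f (fst st')) \<subseteq> letters D"
        using subst_word_letters[OF D(1), of "fst st'" f] that gens_letters[of D f]
        by (auto simp: normal_form_def)
      ultimately show ?thesis by (fastforce simp: state_word_def)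
    qed
    have sl: "fst ` set (snd s) \<subseteq> letters D"
      using s gens_letters[of D "fst s"] by (auto simp: fgroup_def)
    have wl: "fst ` set (concat (map snd w)) \<subseteq> letters D"
    proof -
      have "fst ` set g \<subseteq> letters D" if "(f, g) \<in> set w" for f g
        using that Cons.prems gens_letters[of D f] by (fastforce simp: fgroup_def)
      then show ?thesis by fastforce
    qed
    note sc = step_correct[OF D s st]
    have "element_of D (state_word D (step D s st) (fst s)) =
        element_of D (snd s @ state_word D st (fst s))"
      by (metis sc(2) element_of_reduce)
    also have "\<dots> = element_of D (snd s @ concat (map snd w))"
      using element_of_append[OF D(1) sl letters[OF st]] element_of_append[OF D(1) sl wl] eq
      by simp
    finally have main: "element_of D (state_word D (step D s st) (fst s)) =
        element_of D (concat (map snd (s # w)))" by simp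
    have indep: "element_of D (state_word D st' f) = element_of D (state_word D st' f')"
      if nf: "normal_form D st'" for st' f f'
    proof -
      have c: "fst st' \<in> c_words D" using nf by (simp add: normal_form_def)
      have l1: "fst ` set (subst_word D f (fst st')) \<subseteq> letters D" for f
        using subst_word_letters[OF D(1) c, of f] gens_letters[of D f] by blast
      have l2: "fst ` set (concat (map snd (snd st'))) \<subseteq> letters D"
        using letters[OF nf, of f] by (auto simp: state_word_def)
      have "element_of D (subst_word D f (fst st')) = element_of D (subst_word D f' (fst st'))"
        using element_of_subst_word[OF D(1) c] by (cases f; cases f') auto
      then show ?thesis
        unfolding state_word_def by (simp add: element_of_append[OF D(1) l1 l2])
    qed
    have "algorithm_II D (s # w) = step D s st" by (simp add: algorithm_II_def st_def)
    then show ?case using sc(1) main indep[OF sc(1)] by metis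
  qed
  then show "normal_form D (algorithm_II D w)"
    "element_of D (state_word D (algorithm_II D w) f) = element_of D (concat (map snd w))"
    by auto
qed

end

theory Submission
  imports Defs "HOL-Library.Product_Plus"
begin

text \<open>
  Upper bound: rewriting multiplies \<open>|c\<^sub>j|\<close> by at most \<open>\<lambda>\<close> and a pass adds at most \<open>M + |g\<^sub>j|\<close>, so every
  word that is split has length at most \<open>\<lambda>\<^sup>k (|w| + k M)\<close>. A pass is linear in the sum of at most
  \<open>k\<close> such lengths, and there are \<open>k\<close> passes; this suffices because \<open>k \<le> |w|\<close>.

  Lower bound: take \<open>C\<close> free on \<open>z\<^sub>0, z\<^sub>1, z\<^sub>2\<close>, of index \<open>2\<close> in both free groups of rank \<open>2\<close>.
  Conjugation by \<open>s \<in> A - C\<close> and by \<open>s \<in> B - C\<close> induces two automorphisms of \<open>C\<close>. If the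
  identification of the two subgroups is twisted by \<open>z\<^sub>1 \<mapsto> z\<^sub>1 z\<^sub>2\<^sup>3\<close>, then the composite acts on the
  exponent sums of \<open>z\<^sub>1\<close> and \<open>z\<^sub>2\<close> by a hyperbolic matrix, so pulling \<open>z\<^sub>1\<close> through \<open>(s\<^sub>A s\<^sub>B)\<^sup>n\<close>
  produces words in \<open>C\<close> of exponential length. The index is finite, so bounded constants take care
  of the assumptions on the subalgorithms, which are run by a transducer with two states.
\<close>

section \<open>The upper bound\<close>

lemma length_push: "length (push a w) \<le> Suc (length w)"
  by (auto simp: push_def split: list.splits)

lemma length_reduce: "length (reduce w) \<le> length w"
proof (induction w)
  case (Cons a w)
  then show ?case using length_push[of a "reduce w"] by (simp add: reduce_def)
qed simp

lemma length_inv_word [simp]: "length (inv_word w) = length w"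
  by (simp add: inv_word_def)

lemma length_reduce_append:
  "length (reduce (v @ w)) \<le> length (reduce v) + length (reduce w)"
  using length_reduce[of "reduce v @ reduce w"] by simp

lemma clen_append: "clen D f (b @ c) \<le> clen D f b + clen D f c"
  by (simp add: clen_def subst_word_append length_reduce_append)

lemma total_length_Cons [simp]: "total_length (s # w) = length (snd s) + total_length w"
  by (cases s) (simp add: total_length_def)

lemma total_length_Nil [simp]: "total_length [] = 0"
  by (simp add: total_length_def)

section \<open>Output lengths of machines\<close>

lemma length_snd_next_config:
  assumes "\<And>x y. program P x = Some y \<Longrightarrow> length (snd (snd y)) \<le> K"
  shows "length (snd (snd (next_config P cf))) \<le> length (snd (snd cf)) + K"
proof -
  obtain q ss out where "cf = (q, ss, out)" by (cases cf) auto
  then show ?thesis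
    using assms[of "(q, map top_symbol ss)"] by (auto split: option.splits)
qed

text \<open>A finite program has only finitely many output blocks, and the longest one bounds what a
  step can append. Time bounds on the subalgorithms thus bound the number of letters they write,
  which \<open>clen\<close> does not control because of cancellation.\<close>

lemma length_run_output:
  assumes "finite (dom (program P))"
  shows "\<exists>K. \<forall>w. length (run_output P w) \<le> K * run_time P w"
proof -
  let ?lens = "(\<lambda>y. length (snd (snd y))) ` ran (program P)"
  have "finite ?lens" using finite_ran[OF assms] by simp
  then have K: "length (snd (snd y)) \<le> Max ?lens" if "program P x = Some y" for x y
    by (intro Max_ge \<open>finite ?lens\<close> imageI ranI[of _ x]) (rule that)
  have "length (snd (snd (config_at P w n))) \<le> Max ?lens * n" for w n
  proof (induction n)
    case (Suc n)
    have "length (snd (snd (next_config P (config_at P w n)))) \<le>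
        length (snd (snd (config_at P w n))) + Max ?lens"
      by (rule length_snd_next_config) (rule K)
    then show ?case using Suc by (simp add: config_at_def)
  qed (simp add: config_at_def start_def)
  then show ?thesis unfolding run_output_def by blast
qed

section \<open>Consequences of the standing assumptions\<close>

locale admissible =
  fixes D :: "('x, 'c) amalgam" and L M :: real
  assumes sa: "standing_assumptions D L M"
begin

lemma data: "amalgam_data D" and trans: "transversal D f"
  and mem: "solves_membership_search D f" and rep: "solves_coset_rep_search D f"
  using sa by (auto simp: standing_assumptions_def)

lemma clen_other: "c \<in> c_words D \<Longrightarrow> real (clen D (other f) c) \<le> lam D * real (clen D f c)"
  using sa by (auto simp: standing_assumptions_def)

lemma clen_step:
  "input_word D ((f, g) # w) \<Longrightarrow>
    real (clen D f (fst (algorithm_II D ((f, g) # w)))) \<le>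
      real (clen D f (fst (algorithm_II D w))) + M + real (length g)"
  using sa by (simp add: standing_assumptions_def)

lemma Nil_in_csub: "[] \<in> csub D f"
  using subgroup.one_closed[OF csub_subgroup[OF data]] by (simp add: fgroup_def)

lemma M_nonneg: "0 \<le> M"
proof -
  have "real (length c) \<le> real (length (c \<otimes>\<^bsub>fgroup D FA\<^esub> s)) + M"
    if "c \<in> csub D FA" "s \<in> reps D FA" for c s
    using sa that by (simp add: standing_assumptions_def)
  from this[of "[]" "[]"] show ?thesis
    using Nil_in_csub trans[of FA] by (simp add: transversal_def fgroup_def)
qed

lemma emb_nonempty:
  assumes "z \<in> set (zs D)" shows "emb D f z \<noteq> []"
proof
  assume e: "emb D f z = []"
  have z: "z \<in> carrier (amalgamated D)" and g: "group (amalgamated D)"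
    and h: "emb D f \<in> hom (amalgamated D) (fgroup D f)"
    and i: "inj_on (emb D f) (carrier (amalgamated D))"
    and n: "z \<noteq> \<one>\<^bsub>amalgamated D\<^esub>"
    using data assms by (auto simp: amalgam_data_def)
  have "emb D f \<one>\<^bsub>amalgamated D\<^esub> = []"
    using hom_one[OF h g] group_free_group[of "gens D f"] by (simp add: fgroup_def)
  then show False
    using e z i n monoid.one_closed[OF group.is_monoid[OF g]] by (metis inj_onD)
qed

text \<open>If both ratios were below 1, then Max A < Min B <= Max B < Min A <= Max A. The
  denominators are positive by \<open>emb_nonempty\<close>.\<close>

lemma lam_ge_1: "1 \<le> lam D"
proof (cases "zs D = []")
  case False
  let ?len = "\<lambda>f. (\<lambda>z. length (emb D f z)) ` set (zs D)"
  have ne: "?len f \<noteq> {}" "finite (?len f)" for f using False by auto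
  have mm: "Min (?len f) \<le> Max (?len f)" for f using ne[of f] by (simp del: image_is_empty)
  have pos: "0 < Min (?len f)" for f
    using ne[of f] emb_nonempty[of _ f] by (auto simp: Min_gr_iff)
  show ?thesis
  proof (rule ccontr)
    assume "\<not> 1 \<le> lam D"
    then have "gen_ratio D FA FB < 1" "gen_ratio D FB FA < 1"
      using False by (auto simp: lam_def)
    then have "Max (?len FA) < Min (?len FB)" "Max (?len FB) < Min (?len FA)"
      using pos[of FA] pos[of FB] by (simp_all add: gen_ratio_def)
    then show False using mm[of FA] mm[of FB] by linarith
  qed
qed (simp add: lam_def)

lemma rep_carrier: "p \<in> reps D f \<Longrightarrow> p \<in> carrier (fgroup D f)"
  using trans[of f] by (auto simp: transversal_def)

text \<open>The word \<open>h\<close> lies in the coset of its representative, which has minimal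
  length there.\<close>

lemma length_split_rep:
  assumes h: "h \<in> carrier (fgroup D f)"
  shows "length (split_rep D f h) \<le> length h"
proof -
  interpret group "fgroup D f" by (simp add: fgroup_def group_free_group)
  note C = csub_subgroup[OF data, of f]
  have p: "split_rep D f h \<in> reps D f" "split_rep D f h \<in> csub D f #>\<^bsub>fgroup D f\<^esub> h"
    using rep[of f] h by (simp_all add: solves_coset_rep_search_def split_rep_def)
  then have "h \<in> csub D f #>\<^bsub>fgroup D f\<^esub> split_rep D f h"
    using repr_independence[OF p(2) h C] rcos_self[OF h C] by simp
  then show ?thesis using sa p(1) by (auto simp: standing_assumptions_def)
qed

lemma length_split_c_input:
  assumes h: "h \<in> carrier (fgroup D f)"
  shows "split_c_input D f h \<in> carrier (fgroup D f)"
    "length (split_c_input D f h) \<le> 2 * length h"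
proof -
  have "split_rep D f h \<in> carrier (fgroup D f)"
    using rep_carrier split_correct(1)[OF data trans mem rep h] by blast
  then have "fst ` set (h @ inv_word (split_rep D f h)) \<subseteq> gens D f"
    using h by (simp add: fgroup_def image_Un)
  then show "split_c_input D f h \<in> carrier (fgroup D f)"
    unfolding split_c_input_def fgroup_def using fst_set_reduce[of "h @ inv_word (split_rep D f h)" "gens D f"]
    by simp
  show "length (split_c_input D f h) \<le> 2 * length h"
    unfolding split_c_input_def
    using length_reduce[of "h @ inv_word (split_rep D f h)"] length_split_rep[OF h] by simp
qed

text \<open>The bound on \<open>split_c\<close> concerns the number of letters in the generators of
  \<open>C\<close>, not the length of the element: it is this number that governs the cost of the
  next rewriting.\<close>

lemma linear_costs:
  obtains K :: real where "1 \<le> K"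
    "\<And>f h. h \<in> carrier (fgroup D f) \<Longrightarrow> real (length (split_c D f h)) \<le> K * real (length h)"
    "\<And>f h. h \<in> carrier (fgroup D f) \<Longrightarrow> real (split_time D f h) \<le> K * real (length h)"
    "\<And>f c. c \<in> c_words D \<Longrightarrow> real (length (subst_word D f c)) \<le> K * real (length c)"
proof -
  have "\<exists>K. \<forall>w. length (run_output (mem_alg D f) w) \<le> K * run_time (mem_alg D f) w" for f
    using mem[of f] by (intro length_run_output) (simp add: solves_membership_search_def)
  then obtain k where k: "\<And>f w. length (run_output (mem_alg D f) w) \<le> k f * run_time (mem_alg D f) w"
    by metis
  \<comment> \<open>\<open>L\<close> carries no sign condition, but the estimates below multiply
    inequalities by it.\<close>
  define L' where "L' = max L 0"
  define k' where "k' = k FA + k FB"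
  have "k f \<le> k'" for f by (cases f) (auto simp: k'_def)
  then have k': "length (run_output (mem_alg D f) w) \<le> k' * run_time (mem_alg D f) w" for f w
    using k[of f w] by (meson le_trans mult_le_mono1)
  have L: "real (run_time (mem_alg D f) w) \<le> L' * real (length w)"
    "real (run_time (rep_alg D f) w) \<le> L' * real (length w)"
    if "w \<in> carrier (fgroup D f)" for f w
  proof -
    have "L * real (length w) \<le> L' * real (length w)" by (simp add: L'_def mult_right_mono)
    then show "real (run_time (mem_alg D f) w) \<le> L' * real (length w)"
      "real (run_time (rep_alg D f) w) \<le> L' * real (length w)"
      using sa that by (fastforce simp: standing_assumptions_def)+
  qed
  define U where "U = sum_list (map (\<lambda>z. length (emb D FA z) + length (emb D FB z)) (zs D))"
  have U: "length (emb D f z) \<le> U" if "z \<in> set (zs D)" for f z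
  proof -
    have "length (emb D FA z) + length (emb D FB z) \<le> U"
      unfolding U_def using that by (intro member_le_sum_list) auto
    then show ?thesis by (cases f) auto
  qed
  have subst: "length (subst_word D f c) \<le> U * length c" if "c \<in> c_words D" for f c
    using that
  proof (induction c)
    case (Cons a c)
    then have "c \<in> c_words D" "zs D ! fst a \<in> set (zs D)" by (auto simp: c_words_def)
    then show ?case using Cons.IH U[of "zs D ! fst a" f] by (simp add: subst_word_Cons)
  qed (simp add: subst_word_def)
  \<comment> \<open>The summands serve the four claims in turn. The second comes from a membership
    input of length at most \<open>2 * length h\<close>; the third adds \<open>L'\<close> for the
    representative, \<open>2\<close> for the product and \<open>2 * L'\<close> for the membership
    search.\<close>
  define K where "K = 1 + 2 * real k' * L' + (3 * L' + 2) + real U"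
  have L0: "0 \<le> L'" "0 \<le> real k' * L'" by (simp_all add: L'_def)
  show thesis
  proof
    show "1 \<le> K" using L0 by (simp add: K_def)
  next
    fix f h assume h: "h \<in> carrier (fgroup D f)"
    note i = length_split_c_input[OF h]
    have rt: "real (run_time (mem_alg D f) (split_c_input D f h)) \<le> 2 * L' * real (length h)"
      using L(1)[OF i(1)] mult_left_mono[OF of_nat_mono[OF i(2)] L0(1)] by simp
    have "real (length (split_c D f h)) \<le> real (k' * run_time (mem_alg D f) (split_c_input D f h))"
      unfolding split_c_def using k' by (intro of_nat_mono)
    also have "\<dots> \<le> real k' * (2 * L' * real (length h))"
      using rt by (simp add: mult_left_mono)
    also have "\<dots> = (2 * real k' * L') * real (length h)" by simp
    also have "\<dots> \<le> K * real (length h)"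
      using L0 by (intro mult_right_mono) (auto simp: K_def)
    finally show "real (length (split_c D f h)) \<le> K * real (length h)" .
    have "real (split_time D f h) \<le> L' * real (length h) + 2 * real (length h) + 2 * L' * real (length h)"
      unfolding split_time_def using L(2)[OF h] rt length_split_rep[OF h] by simp
    also have "\<dots> = (3 * L' + 2) * real (length h)" by (simp add: algebra_simps)
    also have "\<dots> \<le> K * real (length h)"
      using L0 by (intro mult_right_mono) (auto simp: K_def)
    finally show "real (split_time D f h) \<le> K * real (length h)" .
  next
    fix f c assume "c \<in> c_words D"
    then have "real (length (subst_word D f c)) \<le> real U * real (length c)"
      using subst[of c f] by (metis of_nat_le_iff of_nat_mult)
    also have "\<dots> \<le> K * real (length c)"
      using L0 by (intro mult_right_mono) (auto simp: K_def)
    finally show "real (length (subst_word D f c)) \<le> K * real (length c)" .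
  qed
qed

section \<open>Sizes of the words in a run and the resulting time bound\<close>

lemma algorithm_II_Cons: "algorithm_II D (s # w) = step D s (algorithm_II D w)"
  by (simp add: algorithm_II_def)

lemma input_word_Cons:
  "input_word D (s # w) \<longleftrightarrow> snd s \<noteq> [] \<and> snd s \<in> carrier (fgroup D (fst s)) \<and>
     (w = [] \<or> fst s \<noteq> fst (hd w) \<and> input_word D w)"
  by (cases s) (auto simp: input_word_def)

lemma normal_form_algorithm_II:
  "input_word D w \<or> w = [] \<Longrightarrow> normal_form D (algorithm_II D w)"
  by (rule algorithm_II_correct(1)[OF data trans mem rep]) (auto simp: input_word_def)

lemma length_le_total_length: "input_word D w \<Longrightarrow> length w \<le> total_length w"
proof (induction w)
  case (Cons s w)
  then show ?case by (cases "snd s") (auto simp: input_word_Cons)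
qed simp

text \<open>A closed majorant for the recursion x_j = \<lambda> x_{j+1} + |g_j| + M, which governs
  the lengths of the words that are split.\<close>

definition size_bound :: "'x syllable list \<Rightarrow> real" where
  "size_bound w = lam D ^ length w * (real (total_length w) + real (length w) * M)"

lemma size_bound_Cons:
  "lam D * size_bound w + real (length (snd s)) + M \<le> size_bound (s # w)"
  "size_bound w \<le> size_bound (s # w)" "0 \<le> size_bound w"
  "real (length (snd s)) \<le> size_bound (s # w)"
proof -
  have 1: "1 \<le> lam D ^ length (s # w)" using lam_ge_1 by (rule one_le_power)
  have "size_bound (s # w) =
      lam D * size_bound w + lam D ^ length (s # w) * (real (length (snd s)) + M)"
    by (simp add: size_bound_def algebra_simps)
  \<comment> \<open>The contribution of the new syllable is given the full power of \<lambda>, which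
    is at least 1; this keeps the bound in closed form.\<close>
  moreover have "real (length (snd s)) + M \<le> lam D ^ length (s # w) * (real (length (snd s)) + M)"
    using mult_right_mono[OF 1, of "real (length (snd s)) + M"] M_nonneg by simp
  ultimately show a: "lam D * size_bound w + real (length (snd s)) + M \<le> size_bound (s # w)"
    by simp
  show 0: "0 \<le> size_bound w" using M_nonneg lam_ge_1 by (simp add: size_bound_def)
  then have "size_bound w \<le> lam D * size_bound w" using lam_ge_1
    by (simp add: mult_le_cancel_right1)
  then show "size_bound w \<le> size_bound (s # w)" "real (length (snd s)) \<le> size_bound (s # w)"
    using a M_nonneg 0 by linarith+
qed

text \<open>The word is measured in the factor of the syllable \<open>s\<close> in front of it, that
  is, after the pending rewriting. This is the form that \<open>clen_step\<close> takes as input,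
  and it accounts for the outer factor \<lambda>. The induction alternates \<open>clen_step\<close>
  and \<open>clen_other\<close>.\<close>

lemma clen_algorithm_II:
  assumes "input_word D (s # w)"
  shows "real (clen D (fst s) (fst (algorithm_II D w))) \<le> lam D * size_bound w"
  using assms
proof (induction w arbitrary: s)
  case Nil
  then show ?case using size_bound_Cons(3)[of "[]"] lam_ge_1
    by (simp add: algorithm_II_def clen_def subst_word_def)
next
  case (Cons t w)
  let ?c = "fst (algorithm_II D (t # w))"
  have t: "input_word D (t # w)" and st: "fst s \<noteq> fst t"
    using Cons.prems by (auto simp: input_word_Cons)
  have f: "fst s = other (fst t)" using st by (cases "fst s"; cases "fst t") auto
  have "?c \<in> c_words D"
    using normal_form_algorithm_II[of "t # w"] t by (simp add: normal_form_def)
  then have "real (clen D (fst s) ?c) \<le> lam D * real (clen D (fst t) ?c)"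
    unfolding f by (rule clen_other)
  also have "real (clen D (fst t) ?c) \<le> size_bound (t # w)"
    using clen_step[of "fst t" "snd t" w] Cons.IH[OF t] t size_bound_Cons(1)[of w t] by simp
  finally show ?case using lam_ge_1 by (simp add: mult_left_mono)
qed

lemma absorb_bound:
  assumes "input_word D (s # w)"
  defines "h \<equiv> absorb D s (fst (algorithm_II D w))"
  shows "h \<in> carrier (fgroup D (fst s))" "real (length h) \<le> size_bound (s # w)"
proof -
  let ?c = "fst (algorithm_II D w)"
  have s: "snd s \<in> carrier (fgroup D (fst s))" and "input_word D w \<or> w = []"
    using assms by (auto simp: input_word_Cons)
  then have "?c \<in> c_words D" using normal_form_algorithm_II by (auto simp: normal_form_def)
  then have "fst ` set (snd s @ subst_word D (fst s) ?c) \<subseteq> gens D (fst s)"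
    using s subst_word_letters[OF data, of ?c "fst s"] by (simp add: fgroup_def image_Un)
  from fst_set_reduce[OF this] show "h \<in> carrier (fgroup D (fst s))"
    by (simp add: h_def absorb_def fgroup_def)
  have "length h \<le> length (snd s) + clen D (fst s) ?c"
    using length_reduce[of "snd s @ reduce (subst_word D (fst s) ?c)"]
    by (simp add: h_def absorb_def clen_def)
  then show "real (length h) \<le> size_bound (s # w)"
    using clen_algorithm_II[OF assms(1)] size_bound_Cons(1)[of w s] M_nonneg by linarith
qed

text \<open>
  A representative kept after a merge is no longer than the two representatives that were merged,
  so the representatives in a state have total length at most the sum of all words \<open>h\<close> split so far.
\<close>

lemma algorithm_II_sizes:
  assumes K: "1 \<le> K"
    "\<And>f h. h \<in> carrier (fgroup D f) \<Longrightarrow> real (length (split_c D f h)) \<le> K * real (length h)"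
    "\<And>f h. h \<in> carrier (fgroup D f) \<Longrightarrow> real (split_time D f h) \<le> K * real (length h)"
    "\<And>f c. c \<in> c_words D \<Longrightarrow> real (length (subst_word D f c)) \<le> K * real (length c)"
    and w: "input_word D (s # w)"
    and ps: "real (total_length (snd (algorithm_II D w))) \<le> real (length w) * size_bound w"
    and c: "real (length (fst (algorithm_II D w))) \<le> 2 * K * (real (length w) * size_bound w)"
  shows "real (total_length (snd (algorithm_II D (s # w)))) \<le>
      real (length (s # w)) * size_bound (s # w)" (is ?A)
    "real (length (fst (algorithm_II D (s # w)))) \<le>
      2 * K * (real (length (s # w)) * size_bound (s # w))" (is ?B)
    "real (step_time D s (algorithm_II D w)) \<le>
      (4 * K * K + 2 * K + 4) * (real (length (s # w)) * size_bound (s # w))" (is ?C)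
proof -
  obtain f g where s: "s = (f, g)" by (cases s)
  obtain c ps where st: "algorithm_II D w = (c, ps)" by (cases "algorithm_II D w")
  define h p where "h = absorb D s c" and "p = split_rep D f h"
  have nf: "normal_form D (c, ps)"
    using normal_form_algorithm_II[of w] w by (auto simp: input_word_Cons st)
  define Q where "Q = size_bound (s # w)"
  define k where "k = real (length w)"
  have Q: "size_bound w \<le> Q" "real (length g) \<le> Q" "1 \<le> length g"
    using size_bound_Cons(2)[of w s] size_bound_Cons(4)[of s w] w by (auto simp: Q_def s input_word_Cons Suc_le_eq)
  have k0: "0 \<le> k" "0 \<le> Q" "0 \<le> k * Q"
    using size_bound_Cons(3)[of "s # w"] by (auto simp: k_def Q_def)
  have h: "h \<in> carrier (fgroup D f)" "real (length h) \<le> Q"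
    using absorb_bound[OF w] by (simp_all add: h_def s st Q_def)
  have p: "p \<in> carrier (fgroup D f)" "length p \<le> length h"
    using rep_carrier split_correct(1)[OF data trans mem rep h(1)] length_split_rep[OF h(1)]
    by (auto simp: p_def)
  have kQ: "k * size_bound w \<le> k * Q" using Q(1) by (simp add: k_def mult_left_mono)
  have P: "real (total_length ps) \<le> k * Q" using ps kQ by (simp add: st k_def)
  have Cc: "real (length c) \<le> 2 * K * (k * Q)"
  proof -
    have "2 * K * (k * size_bound w) \<le> 2 * K * (k * Q)" using K(1) by (intro mult_left_mono[OF kQ]) auto
    then show ?thesis using c by (simp add: st k_def)
  qed
  have sc: "real (length (split_c D f h)) \<le> K * Q" "real (split_time D f h) \<le> K * Q"
    using K(2)[OF h(1)] K(3)[OF h(1)] mult_left_mono[OF h(2), of K] K(1) by linarith+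
  have QK: "real (length (split_c D f h)) \<le> 2 * K * ((k + 1) * Q)"
  proof -
    have "0 \<le> K * (k * Q)" "0 \<le> K * Q" using K(1) k0 by auto
    then have "K * Q \<le> 2 * K * ((k + 1) * Q)" by (simp add: algebra_simps)
    then show ?thesis using sc(1) by linarith
  qed
  have r: "real (length (subst_word D f c)) \<le> 2 * K * K * (k * Q)"
  proof -
    have "real (length (subst_word D f c)) \<le> K * real (length c)"
      using K(4) nf by (simp add: normal_form_def)
    also have "\<dots> \<le> K * (2 * K * (k * Q))" using Cc K(1) by (intro mult_left_mono) auto
    finally show ?thesis by simp
  qed
  define mt where "mt = (if p = [] \<or> ps = [] \<or> fst (hd ps) \<noteq> f then 0
          else length p + length (snd (hd ps)) + split_time D f (reduce (p @ snd (hd ps))))"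
  have "?A \<and> ?B \<and> real mt \<le> (1 + K) * ((k + 1) * Q)"
  proof -
    consider "p = []" | "p \<noteq> []" "ps = [] \<or> fst (hd ps) \<noteq> f"
      | p1 qs where "p \<noteq> []" "ps = (f, p1) # qs"
      by (cases ps) force+
    then show ?thesis
    proof cases
      case 1
      then have "step D s (c, ps) = (split_c D f h, ps)"
        by (simp add: step_def Let_def s flip: h_def[unfolded s] p_def)
      then show ?thesis
        using QK P 1 k0 K(1) unfolding algorithm_II_Cons st
        by (simp add: mt_def algebra_simps flip: Q_def k_def)
    next
      case 2
      then have "step D s (c, ps) = (split_c D f h, (f, p) # ps)"
        by (auto simp: step_def Let_def s simp flip: h_def[unfolded s] p_def)
      then show ?thesis
        using QK P 2 k0 K(1) p(2) h(2) unfolding algorithm_II_Cons st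
        by (auto simp add: mt_def algebra_simps simp flip: Q_def k_def)
    next
      case 3
      define h' where "h' = reduce (p @ p1)"
      have "p1 \<in> carrier (fgroup D f)" using nf 3 rep_carrier by (auto simp: normal_form_def)
      then have "fst ` set (p @ p1) \<subseteq> gens D f" using p by (simp add: fgroup_def image_Un)
      from fst_set_reduce[OF this] have h': "h' \<in> carrier (fgroup D f)"
        by (simp add: h'_def fgroup_def)
      have lh': "length h' \<le> length p + length p1"
        using length_reduce[of "p @ p1"] by (simp add: h'_def)
      \<comment> \<open>The adjacent representative \<open>p1\<close> is an entry of
        \<open>ps\<close>, so the bound \<open>k * Q\<close> on the total length covers it;
        \<open>p\<close> adds at most \<open>Q\<close>.\<close>
      have pp: "real (length p + length p1) \<le> (k + 1) * Q"
        using P 3 p(2) h(2) by (simp add: algebra_simps)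
      then have "real (length h') \<le> (k + 1) * Q" using lh' by linarith
      then have Kh': "K * real (length h') \<le> K * ((k + 1) * Q)" using K(1) by (simp add: mult_left_mono)
      have st': "step D s (c, ps) = (split_c D f h @ split_c D f h',
          if split_rep D f h' = [] then qs else (f, split_rep D f h') # qs)"
        using 3 by (simp add: step_def Let_def s h'_def flip: h_def[unfolded s] p_def)
      have "?A"
        using st' lh' length_split_rep[OF h'] 3 P p(2) h(2) unfolding algorithm_II_Cons st
        by (simp add: algebra_simps flip: Q_def k_def)
      \<comment> \<open>The new word replaces the old \<open>c\<close>: it consists of the outputs
        of two splittings, of words of length at most \<open>Q\<close> and
        \<open>(k + 1) * Q\<close>. Hence the factor \<open>2 * K\<close>.\<close>
      moreover have "?B"
      proof -
        have "K * Q \<le> K * ((k + 1) * Q)" using K(1) k0 by (simp add: algebra_simps)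
        then show ?thesis
          using st' K(2)[OF h'] Kh' sc(1) unfolding algorithm_II_Cons st
          by (simp add: algebra_simps flip: Q_def k_def)
      qed
      moreover have "real mt \<le> (1 + K) * ((k + 1) * Q)"
        using 3 pp K(3)[OF h'] Kh' by (simp add: mt_def h'_def algebra_simps)
      ultimately show ?thesis by blast
    qed
  qed
  moreover have "real (step_time D s (c, ps)) \<le>
      1 + 2 * real (length (subst_word D f c)) + real (length g) + real (split_time D f h) + real mt"
    by (simp add: step_time_def Let_def s mt_def p_def flip: h_def[unfolded s])
  ultimately show ?A ?B ?C
  proof -
    assume *: "?A \<and> ?B \<and> real mt \<le> (1 + K) * ((k + 1) * Q)"
      "real (step_time D s (c, ps)) \<le>
      1 + 2 * real (length (subst_word D f c)) + real (length g) + real (split_time D f h) + real mt"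
    then show ?A ?B by auto
    \<comment> \<open>Syllables are non-empty, so \<open>Q\<close> also pays for the unit charged
      for tests and deletions.\<close>
    have "1 \<le> Q" using Q by linarith
    have "0 \<le> K * (k * Q)" "0 \<le> K * Q" "0 \<le> K * (K * Q)" using K(1) k0 by auto
    moreover have "real mt \<le> k * Q + Q + K * (k * Q) + K * Q"
      using * by (simp add: algebra_simps)
    moreover have "2 * real (length (subst_word D f c)) \<le> 4 * (K * (K * (k * Q)))"
      using r by (simp add: ac_simps)
    moreover have "(4 * K * K + 2 * K + 4) * ((k + 1) * Q) =
        4 * (K * (K * (k * Q))) + 4 * (K * (K * Q)) + 2 * (K * (k * Q)) + 2 * (K * Q) + 4 * (k * Q) + 4 * Q"
      by (simp add: algebra_simps)
    ultimately have "real (step_time D s (c, ps)) \<le> (4 * K * K + 2 * K + 4) * ((k + 1) * Q)"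
      using *(2) sc(2) Q(2) \<open>1 \<le> Q\<close> k0 by linarith
    then show ?C by (simp add: st Q_def k_def add.commute)
  qed
qed

text \<open>Each of the k passes costs at most a constant times k times the size bound of its
  suffix, and the size bound grows with the suffix.\<close>

lemma time_II_quadratic:
  obtains K :: real where "0 \<le> K"
    "\<And>w. input_word D w \<Longrightarrow> real (time_II D w) \<le> K * (real (length w))\<^sup>2 * size_bound w"
proof -
  obtain K where K: "1 \<le> K"
    "\<And>f h. h \<in> carrier (fgroup D f) \<Longrightarrow> real (length (split_c D f h)) \<le> K * real (length h)"
    "\<And>f h. h \<in> carrier (fgroup D f) \<Longrightarrow> real (split_time D f h) \<le> K * real (length h)"
    "\<And>f c. c \<in> c_words D \<Longrightarrow> real (length (subst_word D f c)) \<le> K * real (length c)"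
    using linear_costs by blast
  define K' where "K' = 4 * K * K + 2 * K + 4"
  have K': "0 \<le> K'" using K(1) by (simp add: K'_def)
  have "real (total_length (snd (algorithm_II D w))) \<le> real (length w) * size_bound w \<and>
    real (length (fst (algorithm_II D w))) \<le> 2 * K * (real (length w) * size_bound w) \<and>
    real (time_II D w) \<le> K' * (real (length w))\<^sup>2 * size_bound w"
    if "input_word D w \<or> w = []" for w
    using that
  proof (induction w)
    case (Cons s w)
    define n where "n = real (length w)"
    have w: "input_word D w \<or> w = []" using Cons.prems by (auto simp: input_word_Cons)
    note IH = Cons.IH[OF w]
    have sw: "input_word D (s # w)" using Cons.prems by simp
    note S = algorithm_II_sizes[OF K sw, folded K'_def]
    have "real (time_II D (s # w)) \<le>
        K' * n\<^sup>2 * size_bound (s # w) + K' * ((n + 1) * size_bound (s # w))"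
      using IH S(3) mult_left_mono[OF size_bound_Cons(2)[of w s], of "K' * n\<^sup>2"] K'
      by (simp add: n_def add.commute)
    also have "\<dots> = K' * size_bound (s # w) * (n\<^sup>2 + n + 1)" by (simp add: algebra_simps)
    also have "\<dots> \<le> K' * size_bound (s # w) * (n + 1)\<^sup>2"
      using K' size_bound_Cons(3)[of "s # w"]
      by (intro mult_left_mono) (auto simp: n_def power2_eq_square algebra_simps)
    finally have "real (time_II D (s # w)) \<le> K' * (real (length (s # w)))\<^sup>2 * size_bound (s # w)"
      by (simp add: n_def algebra_simps)
    then show ?case using S IH by blast
  qed (simp add: algorithm_II_def)
  then show thesis using that K' by blast
qed

theorem time_II_upper_bound:
  "\<exists>L\<^sub>1 :: real. \<forall>w. input_word D w \<longrightarrow>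
     real (time_II D w) \<le>
       real (length w) * L\<^sub>1 * real (total_length w) * lam D ^ length w * (real (total_length w) + M)"
proof -
  obtain K where K: "0 \<le> K"
    "\<And>w. input_word D w \<Longrightarrow> real (time_II D w) \<le> K * (real (length w))\<^sup>2 * size_bound w"
    using time_II_quadratic by blast
  \<comment> \<open>The choice \<open>L\<^sub>1 = K * (1 + M)\<close> comes from using k <= |w|
    twice: it turns |w| + k M into at most |w| (1 + M), and it bounds one factor of k^2 by |w| +
    M.\<close>
  have "real (time_II D w) \<le> real (length w) * (K * (1 + M)) * real (total_length w) *
      lam D ^ length w * (real (total_length w) + M)" if w: "input_word D w" for w
  proof -
    define k T l where "k = real (length w)" and "T = real (total_length w)" and "l = lam D ^ length w"
    have kT: "k \<le> T" "0 \<le> k" "0 \<le> l"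
      using length_le_total_length[OF w] lam_ge_1 by (simp_all add: k_def T_def l_def)
    have "T + k * M \<le> T * (1 + M)"
      using mult_right_mono[OF kT(1) M_nonneg] by (simp add: algebra_simps)
    then have "size_bound w \<le> l * (T * (1 + M))"
      using kT(3) by (simp add: size_bound_def mult_left_mono flip: k_def T_def l_def)
    then have "K * k\<^sup>2 * size_bound w \<le> K * k\<^sup>2 * (l * (T * (1 + M)))"
      using K(1) by (intro mult_left_mono) auto
    also have "\<dots> = (k * (K * (1 + M)) * T * l) * k" by (simp add: power2_eq_square algebra_simps)
    also have "\<dots> \<le> (k * (K * (1 + M)) * T * l) * (T + M)"
      using K(1) kT M_nonneg by (intro mult_left_mono) auto
    finally show ?thesis using K(2)[OF w] by (simp add: k_def T_def l_def)
  qed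
  then show ?thesis by blast
qed

end

section \<open>Substitutions and exponent sums\<close>

lemma reduce_append_cong:
  "reduce v = reduce v' \<Longrightarrow> reduce w = reduce w' \<Longrightarrow> reduce (v @ w) = reduce (v' @ w')"
  by (metis reduce_append_reduce)

lemma reduce_cancel_word:
  "reduce (v @ inv_word v @ w) = reduce w" "reduce (inv_word v @ v @ w) = reduce w"
  using reduce_cong_left[of "v @ inv_word v" "[]" w] reduce_cong_left[of "inv_word v @ v" "[]" w]
  by (simp_all add: reduce_inv_left reduce_inv_right)

lemma reduce_inv_word_reduce: "reduce (inv_word (reduce v)) = reduce (inv_word v)"
proof -
  have "reduce (inv_word (reduce v)) = reduce (inv_word (reduce v) @ reduce (v @ inv_word v))"
    by (simp add: reduce_inv_right del: reduce_append_reduce)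
  also have "\<dots> = reduce (inv_word (reduce v) @ reduce (reduce v @ inv_word v))" by simp
  also have "\<dots> = reduce (inv_word v)"
    using reduce_cancel_word(2)[of "reduce v" "inv_word v"] by (simp del: reduce_append_reduce(1))
  finally show ?thesis .
qed

definition subst :: "('a \<Rightarrow> 'b word) \<Rightarrow> 'a word \<Rightarrow> 'b word" where
  "subst \<theta> w = concat (map (\<lambda>(i, b). if b then \<theta> i else inv_word (\<theta> i)) w)"

lemma subst_simps [simp]:
  "subst \<theta> [] = []"
  "subst \<theta> (a # w) = (if snd a then \<theta> (fst a) else inv_word (\<theta> (fst a))) @ subst \<theta> w"
  "subst \<theta> (v @ w) = subst \<theta> v @ subst \<theta> w"
  by (auto simp: subst_def split: prod.splits)

lemma subst_inv_word: "subst \<theta> (inv_word w) = inv_word (subst \<theta> w)"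
  by (induction w) (auto simp: inv_word_Cons inv_letter_def)

lemma subst_subst: "subst \<theta> (subst \<eta> w) = subst (\<lambda>i. subst \<theta> (\<eta> i)) w"
  by (induction w) (auto simp: subst_inv_word)

lemma reduce_subst_push: "reduce (subst \<theta> (push a w)) = reduce (subst \<theta> (a # w))"
proof (cases w)
  case (Cons b v)
  then show ?thesis by (auto simp: push_def inv_letter_def reduce_cancel_word)
qed (simp add: push_def)

lemma reduce_Cons: "reduce (a # w) = push a (reduce w)"
  by (simp add: reduce_def)

text \<open>A substitution is a homomorphism of free groups: a cancelling pair of letters becomes a
  word next to its inverse. Reduction being a sequence of pushes, one push suffices.\<close>

lemma reduce_subst_reduce: "reduce (subst \<theta> (reduce w)) = reduce (subst \<theta> w)"
proof (induction w)
  case (Cons a w)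
  then show ?case
    unfolding reduce_Cons reduce_subst_push subst_simps by (intro reduce_cong_right)
qed simp

lemma reduce_subst_cong:
  assumes "\<And>i. reduce (\<theta> i) = reduce (\<eta> i)"
  shows "reduce (subst \<theta> w) = reduce (subst \<eta> w)"
proof (induction w)
  case (Cons a w)
  have "reduce (inv_word (\<theta> i)) = reduce (inv_word (\<eta> i))" for i
    by (metis assms reduce_inv_word_reduce)
  then have "reduce (subst \<theta> [a]) = reduce (subst \<eta> [a])" using assms by simp
  then have "reduce (subst \<theta> [a] @ subst \<theta> w) = reduce (subst \<eta> [a] @ subst \<eta> w)"
    using Cons.IH by (rule reduce_append_cong)
  then show ?case by simp
qed simp

lemma subst_letters:
  assumes "\<And>i. fst ` set (\<theta> i) \<subseteq> X" shows "fst ` set (subst \<theta> w) \<subseteq> X"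
proof (induction w)
  case (Cons a w)
  then show ?case using assms by (simp add: image_Un)
qed simp

lemma length_subst:
  assumes "\<And>i. length (\<theta> i) \<le> K" shows "length (subst \<theta> w) \<le> K * length w"
proof (induction w)
  case (Cons a w)
  then show ?case using assms[of "fst a"] by simp
qed simp

definition expo :: "'a \<Rightarrow> 'a word \<Rightarrow> int" where
  "expo i w = (\<Sum>a\<leftarrow>w. if fst a = i then (if snd a then 1 else - 1) else 0)"

lemma expo_simps [simp]:
  "expo i [] = 0"
  "expo i (a # w) = (if fst a = i then (if snd a then 1 else - 1) else 0) + expo i w"
  "expo i (v @ w) = expo i v + expo i w"
  by (auto simp: expo_def)

lemma expo_reduce [simp]: "expo i (reduce w) = expo i w"
proof (induction w)
  case (Cons a w)
  have "expo i (push a v) = expo i (a # v)" for v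
    by (cases v) (auto simp: push_def inv_letter_def)
  then show ?case using Cons.IH by (simp add: reduce_Cons)
qed simp

text \<open>This turns exponent sums, which can be followed by linear algebra through all
  reductions, into lower bounds for the words actually written.\<close>

lemma expo_le_length: "\<bar>expo i w\<bar> \<le> int (length w)"
  by (induction w) auto

section \<open>Sequential transducers that track a parity\<close>

fun parity :: "bool \<Rightarrow> nat word \<Rightarrow> bool" where
  "parity q [] = q"
| "parity q (a # w) = parity (q \<noteq> even (fst a)) w"

fun transduce :: "(bool \<Rightarrow> nat letter \<Rightarrow> 'o list) \<Rightarrow> bool \<Rightarrow> nat word \<Rightarrow> 'o list" where
  "transduce out q [] = []"
| "transduce out q (a # w) = out q a @ transduce out (q \<noteq> even (fst a)) w"

lemma parity_append [simp]: "parity q (v @ w) = parity (parity q v) w"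
  by (induction v arbitrary: q) auto

lemma transduce_append [simp]:
  "transduce out q (v @ w) = transduce out q v @ transduce out (parity q v) w"
  by (induction v arbitrary: q) auto

text \<open>Parity is a homomorphism to Z/2, so the initial state is merely added to the
  result.\<close>

lemma parity_shift: "parity q w = (q \<noteq> parity False w)"
proof (induction w arbitrary: q)
  case (Cons a w)
  show ?case using Cons.IH[of "q \<noteq> even (fst a)"] Cons.IH[of "False \<noteq> even (fst a)"] by auto
qed simp

lemma parity_reduce [simp]: "parity q (reduce w) = parity q w"
proof (induction w arbitrary: q)
  case (Cons a w)
  have "parity q (push a v) = parity q (a # v)" for v
    by (cases v; cases "even (fst a)") (auto simp: push_def inv_letter_def)
  then show ?case using Cons.IH by (simp add: reduce_Cons)
qed simp

lemma parity_inv_word [simp]: "parity q (inv_word w) = parity q w"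
proof (induction w arbitrary: q)
  case (Cons a w)
  then show ?case
    using parity_shift[of q w] parity_shift[of "q \<noteq> even (fst a)" w] by (auto simp: inv_word_Cons)
qed simp

lemma transduce_empty [simp]: "transduce (\<lambda>q a. []) q w = []"
  by (induction w arbitrary: q) auto

text \<open>By the hypothesis, the inverse of a letter, read in the state which that letter leads
  to, undoes its output; it also restores the state. So a cancelling pair in the input yields a
  cancelling pair of words in the output.\<close>

lemma reduce_transduce_reduce:
  assumes "\<And>q a. out (q \<noteq> even (fst a)) (inv_letter a) = inv_word (out q a)"
  shows "reduce (transduce out q (reduce w)) = reduce (transduce out q w)"
proof (induction w arbitrary: q)
  case (Cons a w)
  have "reduce (transduce out q (push a v)) = reduce (transduce out q (a # v))" for v
  proof (cases v)
    case (Cons b u)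
    show ?thesis
    proof (cases "b = inv_letter a")
      case True
      have q: "((q \<noteq> even (fst a)) \<noteq> even (fst a)) = q" by auto
      have "transduce out q (a # v) = out q a @ inv_word (out q a) @ transduce out q u"
        unfolding Cons True transduce.simps inv_letter_simps q assms ..
      then show ?thesis using Cons True by (simp add: push_def reduce_cancel_word)
    qed (simp add: Cons push_def)
  qed (simp add: push_def)
  then show ?case
    using reduce_cong_right[OF Cons.IH[of "q \<noteq> even (fst a)"]] by (simp add: reduce_Cons)
qed simp

text \<open>
  The machine reads its input from left to right with the parity as its state. If \<open>fin = Some u\<close>, it
  makes one more step on an input of odd parity, in which it writes \<open>u\<close>.
\<close>

definition parity_prog ::
  "nat set \<Rightarrow> (bool \<Rightarrow> nat letter \<Rightarrow> 'o list) \<Rightarrow> 'o list option \<Rightarrow> (nat letter, 'o) prog" where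
  "parity_prog X out fin = (\<lambda>(n, ts).
     if n < 2 \<and> ts \<in> (\<lambda>a. [Some (Inl a)]) ` (X \<times> UNIV) then
       (let a = projl (the (hd ts))
        in Some (of_bool ((n = 1) \<noteq> even (fst a)), [[]], out (n = 1) a))
     else if n = 1 \<and> ts = [None] then map_option (\<lambda>u. (2, [[]], u)) fin
     else None)"

definition parity_machine ::
  "nat set \<Rightarrow> (bool \<Rightarrow> nat letter \<Rightarrow> 'o list) \<Rightarrow> 'o list option \<Rightarrow> (nat letter, 'o) machine" where
  "parity_machine X out fin = \<lparr>aux_stacks = 0, program = parity_prog X out fin, accepting = {0}\<rparr>"

lemma finite_dom_parity_machine:
  assumes "finite X" shows "finite (dom (program (parity_machine X out fin)))"
proof -
  have "dom (parity_prog X out fin) \<subseteq>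
      {..<2} \<times> insert [None] ((\<lambda>a. [Some (Inl a)]) ` (X \<times> UNIV))"
    unfolding dom_def parity_prog_def by (rule subsetI) (auto split: if_splits)
  then have "finite (dom (parity_prog X out fin))"
    by (rule finite_subset) (simp add: assms)
  then show ?thesis by (simp add: parity_machine_def)
qed

lemma next_config_halted: "halted P cf \<Longrightarrow> (next_config P ^^ n) cf = cf"
proof (induction n)
  case (Suc n)
  then show ?case by (cases cf) auto
qed simp

text \<open>A halted configuration is a fixed point. Any halting time therefore determines the
  result, and the least one need not be computed.\<close>

lemma halted_config_at:
  assumes "halted P (config_at P w n)"
  shows "halts P w" "run_time P w \<le> n" "config_at P w (run_time P w) = config_at P w n"
proof -
  show "halts P w" using assms by (auto simp: halts_def)
  show le: "run_time P w \<le> n" unfolding run_time_def using assms by (rule Least_le)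
  have h: "halted P (config_at P w (run_time P w))" unfolding run_time_def using assms by (rule LeastI)
  have "config_at P w n = (next_config P ^^ (n - run_time P w)) (config_at P w (run_time P w))"
    unfolding config_at_def by (metis comp_apply funpow_add le le_add_diff_inverse2)
  then show "config_at P w (run_time P w) = config_at P w n"
    using next_config_halted[OF h] by simp
qed

lemma parity_machine_steps:
  assumes "fst ` set v \<subseteq> X"
  shows "(next_config (parity_machine X out fin) ^^ length v) (of_bool q, [map Inl (v @ w)], u) =
    (of_bool (parity q v), [map Inl w], u @ transduce out q v)"
  using assms
proof (induction v arbitrary: q u)
  case (Cons a v)
  have "next_config (parity_machine X out fin) (of_bool q, [map Inl ((a # v) @ w)], u) =
      (of_bool (q \<noteq> even (fst a)), [map Inl (v @ w)], u @ out q a)"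
    using Cons.prems by (cases a) (auto simp: parity_machine_def parity_prog_def top_symbol_def)
  then show ?case
    using Cons by (simp add: funpow_swap1)
qed simp

lemma config_at_parity_machine:
  assumes "fst ` set w \<subseteq> X"
  shows "config_at (parity_machine X out fin) w (length w) =
    (of_bool (parity False w), [[]], transduce out False w)"
  using parity_machine_steps[OF assms, of out fin False "[]" "[]"]
  by (simp add: config_at_def start_def parity_machine_def)

lemma parity_machine_None:
  assumes w: "fst ` set w \<subseteq> X"
  shows "halts (parity_machine X out None) w" "run_time (parity_machine X out None) w \<le> length w"
    "accepts (parity_machine X out None) w \<longleftrightarrow> \<not> parity False w"
    "run_output (parity_machine X out None) w = transduce out False w"
proof -
  let ?P = "parity_machine X out None"
  have "halted ?P (config_at ?P w (length w))"
    unfolding config_at_parity_machine[OF w]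
    by (auto simp: parity_machine_def parity_prog_def top_symbol_def)
  note h = halted_config_at[OF this]
  show "halts ?P w" "run_time ?P w \<le> length w" by (rule h)+
  show "accepts ?P w \<longleftrightarrow> \<not> parity False w" "run_output ?P w = transduce out False w"
    unfolding accepts_def run_output_def h(3) config_at_parity_machine[OF w]
    by (auto simp: parity_machine_def)
qed

lemma parity_machine_Some:
  assumes w: "fst ` set w \<subseteq> X"
  shows "halts (parity_machine X out (Some u)) w"
    "run_time (parity_machine X out (Some u)) w \<le> length w + of_bool (parity False w)"
    "run_output (parity_machine X out (Some u)) w =
       transduce out False w @ (if parity False w then u else [])"
proof -
  let ?P = "parity_machine X out (Some u)" and ?n = "length w + of_bool (parity False w)"
  have c: "config_at ?P w ?n = (if parity False w then 2 else 0, [[]],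
      transduce out False w @ (if parity False w then u else []))"
  proof (cases "parity False w")
    case True
    then have "config_at ?P w ?n = next_config ?P (config_at ?P w (length w))"
      by (simp add: config_at_def)
    then show ?thesis
      unfolding config_at_parity_machine[OF w] using True
      by (simp add: parity_machine_def parity_prog_def top_symbol_def image_iff)
  qed (simp add: config_at_parity_machine[OF w])
  have "halted ?P (config_at ?P w ?n)"
    unfolding c by (auto simp: parity_machine_def parity_prog_def top_symbol_def)
  note h = halted_config_at[OF this]
  show "halts ?P w" "run_time ?P w \<le> ?n" by (rule h)+
  show "run_output ?P w = transduce out False w @ (if parity False w then u else [])"
    unfolding run_output_def h(3) c by simp
qed

section \<open>An amalgam with exponential growth\<close>

fun s_gen :: "factor \<Rightarrow> nat" where
  "s_gen FA = 0"
| "s_gen FB = 2"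

text \<open>With twist k, conjugation by \<open>s\<close> acts on the exponent sums of z_1, z_2 by
  (a, b) -> (k a + b, (1 - k^2) a - k b). Its composite with the swap for twist 0 has determinant 1
  and trace 2 - k^2, so 3 is the least natural k for which it is hyperbolic.\<close>

fun twist :: "factor \<Rightarrow> nat" where
  "twist FA = 0"
| "twist FB = 3"

text \<open>
  With \<open>k = twist f\<close>, the subgroup \<open>C\<close> of words with an even number of letters \<open>s\<^sup>\<plusminus>\<^sup>1\<close> has the basis
  \<open>s s\<close>, \<open>t s t\<^sup>k s\<inverse>\<close>, \<open>s t s\<inverse>\<close>. In both factors the number of the
  generator \<open>s\<close> is even and that of \<open>t\<close> is odd, so the parity of a word is its coset.
\<close>

definition basis :: "factor \<Rightarrow> nat \<Rightarrow> nat word" where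
  "basis f i =
     (let s = (s_gen f, True); t = (Suc (s_gen f), True); s' = (s_gen f, False)
      in if i = 0 then [s, s] else if i = 1 then [t, s] @ replicate (twist f) t @ [s'] else [s, t, s'])"

text \<open>
  \<open>rewrite_pos f q x\<close> is \<open>r x r'\<inverse>\<close> in this basis, with \<open>r\<close> and \<open>r'\<close> the representatives of the
  cosets before and after reading \<open>x\<close>; \<open>q\<close> tells whether the coset before is the nontrivial one.
\<close>

definition rewrite_pos :: "factor \<Rightarrow> bool \<Rightarrow> nat \<Rightarrow> nat word" where
  "rewrite_pos f q x =
     (if even x then (if q then [(0, True)] else [])
      else if q then [(2, True)] else (1, True) # replicate (twist f) (2, False))"

text \<open>For a negative letter, r x^-1 r'^-1 is the inverse of r' x r^-1: the positive letter is
  read from the coset that the negative one leads to.\<close>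

definition rewrite_letter :: "factor \<Rightarrow> bool \<Rightarrow> nat letter \<Rightarrow> nat word" where
  "rewrite_letter f q a =
     (if snd a then rewrite_pos f q (fst a)
      else inv_word (rewrite_pos f (q \<noteq> even (fst a)) (fst a)))"

abbreviation rewrite :: "factor \<Rightarrow> bool \<Rightarrow> nat word \<Rightarrow> nat word" where
  "rewrite f \<equiv> transduce (rewrite_letter f)"

definition coset_rep :: "factor \<Rightarrow> bool \<Rightarrow> nat word" where
  "coset_rep f q = (if q then [(s_gen f, True)] else [])"

abbreviation fgens :: "factor \<Rightarrow> nat set" where
  "fgens f \<equiv> {s_gen f, Suc (s_gen f)}"

lemma even_s_gen [simp]: "even (s_gen f)"
  by (cases f) auto

lemma basis_simps:
  "basis FA i = (if i = 0 then [(0, True), (0, True)]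
     else if i = 1 then [(1, True), (0, True), (0, False)] else [(0, True), (1, True), (0, False)])"
  "basis FB i = (if i = 0 then [(2, True), (2, True)]
     else if i = 1 then [(3, True), (2, True), (3, True), (3, True), (3, True), (2, False)]
     else [(2, True), (3, True), (2, False)])"
  by (simp_all add: basis_def Let_def numeral_eq_Suc)

lemma rewrite_pos_simps:
  "rewrite_pos FA q x = (if even x then (if q then [(0, True)] else [])
     else if q then [(2, True)] else [(1, True)])"
  "rewrite_pos FB q x = (if even x then (if q then [(0, True)] else [])
     else if q then [(2, True)] else [(1, True), (2, False), (2, False), (2, False)])"
  by (simp_all add: rewrite_pos_def numeral_3_eq_3)

lemmas compute = basis_simps rewrite_letter_def rewrite_pos_simps coset_rep_def inv_word_def
  inv_letter_def reduce_Cons push_def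

lemma reduce_rewrite: "reduce (rewrite f q (reduce w)) = reduce (rewrite f q w)"
proof (rule reduce_transduce_reduce)
  fix q and a :: "nat letter"
  show "rewrite_letter f (q \<noteq> even (fst a)) (inv_letter a) = inv_word (rewrite_letter f q a)"
    by (cases "even (fst a)") (simp_all add: rewrite_letter_def inv_letter_def)
qed

lemma basis_letters: "fst ` set (basis f i) \<subseteq> fgens f"
  by (auto simp: basis_def Let_def)

lemma parity_basis [simp]: "parity q (basis f i) = q"
  by (cases f; cases q) (simp_all add: basis_simps)

lemma parity_subst_basis [simp]: "parity q (subst (basis f) c) = q"
  by (induction c arbitrary: q) auto

lemma rewrite_basis:
  assumes "i < 3"
  shows "reduce (rewrite f False (basis f i)) = [(i, True)]"
    "reduce (rewrite f False (inv_word (basis f i))) = [(i, False)]"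
proof -
  have "i = 0 \<or> i = 1 \<or> i = 2" using assms by auto
  then show "reduce (rewrite f False (basis f i)) = [(i, True)]"
    "reduce (rewrite f False (inv_word (basis f i))) = [(i, False)]"
    by (cases f; auto simp: compute)+
qed

text \<open>Basis words have even parity, so the state is back at \<open>False\<close> after each of
  them and the rewriting splits letter by letter. This left inverse of the substitution shows that
  the basis is free.\<close>

lemma rewrite_subst_basis:
  assumes "fst ` set c \<subseteq> {..<3}"
  shows "reduce (rewrite f False (subst (basis f) c)) = reduce c"
  using assms
proof (induction c)
  case (Cons a c)
  have "reduce (rewrite f False (subst (basis f) [a])) = reduce [a]"
    using rewrite_basis[of "fst a" f] Cons.prems
    by (cases a) (auto simp: reduce_def push_def)
  then have "reduce (rewrite f False (subst (basis f) [a]) @ rewrite f False (subst (basis f) c)) =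
      reduce ([a] @ c)"
    using Cons by (intro reduce_append_cong) auto
  then show ?case by (simp split: if_splits)
qed simp

lemma rewrite_letters: "fst ` set (rewrite f q w) \<subseteq> {..<3}"
proof (induction w arbitrary: q)
  case (Cons a w)
  have "fst ` set (rewrite_letter f q a) \<subseteq> {..<3}"
    by (auto simp: rewrite_letter_def rewrite_pos_def)
  then show ?case using Cons.IH by (simp add: image_Un)
qed simp

lemma length_rewrite: "length (rewrite f q w) \<le> 4 * length w"
proof (induction w arbitrary: q)
  case (Cons a w)
  have "length (rewrite_letter f q a) \<le> 4"
    by (cases f) (simp_all add: rewrite_letter_def rewrite_pos_def)
  then show ?case using Cons.IH[of "q \<noteq> even (fst a)"] by simp
qed simp

text \<open>The Schreier factors r x r'^-1 telescope: the representative that ends one factor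
  cancels the one that begins the next.\<close>

lemma subst_basis_rewrite:
  assumes "fst ` set w \<subseteq> fgens f"
  shows "reduce (subst (basis f) (rewrite f q w)) =
    reduce (coset_rep f q @ w @ inv_word (coset_rep f (parity q w)))"
  using assms
proof (induction w arbitrary: q)
  case (Cons a w)
  define q' where "q' = (q \<noteq> even (fst a))"
  have "fst a = s_gen f \<or> fst a = Suc (s_gen f)" using Cons.prems by auto
  then have a: "reduce (subst (basis f) (rewrite_letter f q a)) =
      reduce (coset_rep f q @ [a] @ inv_word (coset_rep f q'))"
    by (cases a; cases f; cases q; cases "snd a"; auto simp: compute q'_def)
  have IH: "reduce (subst (basis f) (rewrite f q' w)) =
      reduce (coset_rep f q' @ w @ inv_word (coset_rep f (parity q' w)))"
    using Cons by auto
  have "reduce (subst (basis f) (rewrite f q (a # w))) =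
      reduce (subst (basis f) (rewrite_letter f q a) @ subst (basis f) (rewrite f q' w))"
    by (simp add: q'_def)
  also have "\<dots> = reduce ((coset_rep f q @ [a] @ inv_word (coset_rep f q')) @
      coset_rep f q' @ w @ inv_word (coset_rep f (parity q' w)))"
    using a IH by (rule reduce_append_cong)
  also have "\<dots> = reduce ((coset_rep f q @ [a]) @ w @ inv_word (coset_rep f (parity q' w)))"
    using reduce_cong_right[OF reduce_cancel_word(2), of "coset_rep f q @ [a]"] by simp
  finally show ?case by (simp add: q'_def)
qed (simp add: reduce_inv_right)

text \<open>The redundant last generator \<open>z\<^sub>0\<^sup>1\<^sup>2\<close> raises \<open>\<lambda>\<close> to \<open>24\<close>, as needed for \<open>clen_other_TA\<close>.\<close>

definition twisted_amalgam :: "(nat, nat word) amalgam" where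
  "twisted_amalgam = \<lparr>
     gens = fgens,
     amalgamated = free_group {..<3},
     zs = [[(0, True)], [(1, True)], [(2, True)], replicate 12 (0, True)],
     emb = (\<lambda>f c. reduce (subst (basis f) c)),
     reps = (\<lambda>f. range (coset_rep f)),
     mem_alg = (\<lambda>f. parity_machine (fgens f) (rewrite_letter f) None),
     rep_alg = (\<lambda>f. parity_machine (fgens f) (\<lambda>q a. []) (Some (coset_rep f True)))\<rparr>"

abbreviation TA :: "(nat, nat word) amalgam" where "TA \<equiv> twisted_amalgam"

section \<open>The standing assumptions for the twisted amalgam\<close>

lemma TA_sel [simp]:
  "gens TA f = fgens f" "amalgamated TA = free_group {..<3}"
  "emb TA f c = reduce (subst (basis f) c)" "reps TA f = range (coset_rep f)"
  "mem_alg TA f = parity_machine (fgens f) (rewrite_letter f) None"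
  "rep_alg TA f = parity_machine (fgens f) (\<lambda>q a. []) (Some (coset_rep f True))"
  "fgroup TA f = free_group (fgens f)"
  by (simp_all add: twisted_amalgam_def fgroup_def)

lemma zs_TA: "zs TA = [[(0, True)], [(1, True)], [(2, True)], replicate 12 (0, True)]"
  by (simp add: twisted_amalgam_def)

lemma emb_TA_hom: "emb TA f \<in> hom (free_group {..<3}) (fgroup TA f)"
proof (rule homI)
  fix v :: "nat word"
  show "emb TA f v \<in> carrier (fgroup TA f)"
    using fst_set_reduce[OF subst_letters[OF basis_letters]] by simp
next
  fix v w :: "nat word"
  show "emb TA f (v \<otimes>\<^bsub>free_group {..<3}\<^esub> w) = emb TA f v \<otimes>\<^bsub>fgroup TA f\<^esub> emb TA f w"
    by (simp add: reduce_subst_reduce)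
qed

lemma rewrite_emb_TA:
  assumes "c \<in> carrier (free_group {..<3})"
  shows "reduce (rewrite f False (emb TA f c)) = c"
  using assms by (simp add: reduce_rewrite rewrite_subst_basis reduce_reduced)

lemma emb_TA_inj: "inj_on (emb TA f) (carrier (free_group {..<3}))"
  using rewrite_emb_TA by (rule inj_on_inverseI)

text \<open>Basis words are even. Conversely, rewriting an even word from the trivial coset ends in
  the trivial coset, so \<open>subst_basis_rewrite\<close> leaves no representatives over and yields
  a preimage.\<close>

lemma csub_TA: "csub TA f = {w \<in> carrier (free_group (fgens f)). \<not> parity False w}"
proof (intro equalityI subsetI)
  fix w assume "w \<in> csub TA f"
  then obtain x where "w = reduce (subst (basis f) x)" by (auto simp: csub_def)
  then show "w \<in> {w \<in> carrier (free_group (fgens f)). \<not> parity False w}"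
    using fst_set_reduce[OF subst_letters[OF basis_letters], of f "\<lambda>i. i" x] by simp
next
  fix w assume w: "w \<in> {w \<in> carrier (free_group (fgens f)). \<not> parity False w}"
  let ?c = "reduce (rewrite f False w)"
  have "emb TA f ?c = w"
    using w subst_basis_rewrite[of w f False]
    by (simp add: reduce_subst_reduce coset_rep_def reduce_reduced)
  moreover have "?c \<in> carrier (free_group {..<3})"
    using fst_set_reduce[OF rewrite_letters] by simp
  ultimately show "w \<in> csub TA f" unfolding csub_def TA_sel(2) by (metis imageI)
qed

lemma coset_TA:
  assumes "w \<in> carrier (free_group (fgens f))"
  shows "v \<in> csub TA f #>\<^bsub>fgroup TA f\<^esub> w \<longleftrightarrow>
    v \<in> carrier (free_group (fgens f)) \<and> parity False v = parity False w"
proof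
  assume "v \<in> csub TA f #>\<^bsub>fgroup TA f\<^esub> w"
  then obtain c where c: "c \<in> csub TA f" "v = reduce (c @ w)" by (auto simp: r_coset_def)
  then have "fst ` set (c @ w) \<subseteq> fgens f" using assms by (auto simp: csub_TA)
  from fst_set_reduce[OF this] show
    "v \<in> carrier (free_group (fgens f)) \<and> parity False v = parity False w"
    using c parity_shift[of "parity False c" w] by (simp add: csub_TA)
next
  assume v: "v \<in> carrier (free_group (fgens f)) \<and> parity False v = parity False w"
  let ?c = "reduce (v @ inv_word w)"
  have "fst ` set (v @ inv_word w) \<subseteq> fgens f" using v assms by (simp add: image_Un)
  from fst_set_reduce[OF this] have "?c \<in> csub TA f"
    using v parity_shift[of "parity False v" w] by (simp add: csub_TA)
  moreover have "v = reduce (?c @ w)"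
    using v reduce_cong_right[of "inv_word w @ w" "[]" v] by (simp add: reduce_inv_left reduce_reduced)
  ultimately show "v \<in> csub TA f #>\<^bsub>fgroup TA f\<^esub> w"
    unfolding r_coset_def TA_sel(7) free_group_simps(2) by blast
qed

lemma coset_rep_carrier: "coset_rep f q \<in> carrier (free_group (fgens f))"
  by (simp add: coset_rep_def)

lemma parity_coset_rep [simp]: "parity False (coset_rep f q) = q"
  by (simp add: coset_rep_def)

lemma generate_free_group:
  fixes X :: "'x set"
  shows "w \<in> carrier (free_group X) \<Longrightarrow> w \<in> generate (free_group X) ((\<lambda>x. [(x, True)]) ` X)"
proof (induction w)
  case Nil
  then show ?case using generate.one[of "free_group X"] by simp
next
  case (Cons a w)
  let ?G = "generate (free_group X) ((\<lambda>x. [(x, True)]) ` X)"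
  have a: "[(fst a, True)] \<in> (\<lambda>x. [(x, True)]) ` X" using Cons.prems by simp
  have inv: "inv\<^bsub>free_group X\<^esub> [(fst a, True)] = [(fst a, False)]"
    using Cons.prems by (subst inv_free_group) (auto simp: inv_word_def inv_letter_def)
  have "[a] \<in> ?G"
    using generate.incl[OF a, of "free_group X"] generate.inv[OF a, of "free_group X"] inv
    by (cases a; cases "snd a") auto
  moreover have "w \<in> ?G" using Cons by auto
  ultimately have "[a] \<otimes>\<^bsub>free_group X\<^esub> w \<in> ?G" by (rule generate.eng)
  then show ?case using Cons.prems by (simp add: reduce_reduced del: reduced_simps)
qed

lemma amalgam_data_TA: "amalgam_data TA"
proof -
  have Z: "set (zs TA) \<subseteq> carrier (free_group {..<3})"
    by (simp add: zs_TA numeral_eq_Suc inv_letter_def)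
  have "(\<lambda>x. [(x, True)]) ` {..<3} \<subseteq> set (zs TA)"
    by (auto simp: zs_TA)
  then have "carrier (free_group {..<3}) \<subseteq> generate (free_group {..<3}) (set (zs TA))"
    using generate_free_group[of _ "{..<3}"] group.mono_generate[OF group_free_group] by blast
  moreover have "generate (free_group {..<3}) (set (zs TA)) \<subseteq> carrier (free_group {..<3})"
    using group.generate_incl[OF group_free_group Z] .
  ultimately show ?thesis
    unfolding amalgam_data_def TA_sel(2)
    using Z emb_TA_hom emb_TA_inj group_free_group by (auto simp: zs_TA)
qed

lemma replicate_12: "replicate 12 x = [x, x, x, x, x, x, x, x, x, x, x, x]"
  by (simp add: numeral_eq_Suc)

lemma lam_TA: "lam TA = 24"
proof -
  \<comment> \<open>In \<open>A\<close> the basis word for z_1 collapses to the single letter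
    \<open>t\<close>, so the minima are 1 and 2, while z_0^12 gives the maximum 24 in both factors.
    The ratios are 24 / 2 and 24 / 1.\<close>
  have "length (emb TA f z) =
      (if z = [(0, True)] then 2 else if z = [(1, True)] then (if f = FA then 1 else 6)
       else if z = [(2, True)] then 3 else 24)" if "z \<in> set (zs TA)" for z f
    using that by (cases f) (auto simp: zs_TA compute replicate_12)
  then have "(\<lambda>z. length (emb TA f z)) ` set (zs TA) = {2, if f = FA then 1 else 6, 3, 24}" for f
    by (auto simp: zs_TA numeral_eq_Suc)
  then show ?thesis by (simp add: lam_def gen_ratio_def zs_TA del: TA_sel)
qed

lemma subst_word_eq_subst: "subst_word D f c = subst (\<lambda>i. emb D f (zs D ! i)) c"
  by (simp add: subst_word_def subst_def)

text \<open>Evaluating the word in \<open>C\<close> first, the generator of index 3 included, gives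
  one element x for both factors. Lengths in the two factors can then be compared through the images
  of x.\<close>

lemma reduce_subst_word_TA:
  assumes "c \<in> c_words TA"
  shows "\<exists>x \<in> carrier (free_group {..<3}). \<forall>f. reduce (subst_word TA f c) = emb TA f x"
proof
  let ?x = "reduce (subst ((!) (zs TA)) c)"
  have "fst ` set (subst ((!) (zs TA)) c) \<subseteq> {..<3}"
    using assms
  proof (induction c)
    case (Cons a c)
    have "fst a \<in> {0, 1, 2, 3}" using Cons.prems by (auto simp: c_words_def zs_TA)
    then have "fst ` set (zs TA ! fst a) \<subseteq> {..<3}" by (auto simp: zs_TA)
    then show ?case using Cons by (auto simp: c_words_def image_Un)
  qed simp
  from fst_set_reduce[OF this] show "?x \<in> carrier (free_group {..<3})" by simp
  show "\<forall>f. reduce (subst_word TA f c) = emb TA f ?x"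
  proof
    fix f
    have "subst_word TA f c = subst (\<lambda>i. reduce (subst (basis f) (zs TA ! i))) c"
      unfolding subst_word_eq_subst TA_sel(3) ..
    also have "reduce \<dots> = reduce (subst (\<lambda>i. subst (basis f) (zs TA ! i)) c)"
      by (rule reduce_subst_cong) (simp add: reduce_reduced)
    finally show "reduce (subst_word TA f c) = emb TA f ?x"
      by (simp add: subst_subst reduce_subst_reduce)
  qed
qed

text \<open>Here 24 = 6 * 4: a basis word has at most 6 letters, and rewriting recovers an element
  of \<open>C\<close> from its image with at most 4 letters per letter.\<close>

lemma clen_other_TA:
  assumes "c \<in> c_words TA"
  shows "real (clen TA (other f) c) \<le> lam TA * real (clen TA f c)"
proof -
  obtain x where x: "x \<in> carrier (free_group {..<3})"
    "\<And>f. reduce (subst_word TA f c) = emb TA f x"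
    using reduce_subst_word_TA[OF assms] by blast
  have "length (basis f i) \<le> 6" for f i by (cases f) (simp_all add: basis_def Let_def)
  then have "length (emb TA (other f) x) \<le> 6 * length x"
    using length_reduce le_trans length_subst by (metis TA_sel(3))
  moreover have "length x \<le> 4 * length (emb TA f x)"
    using length_reduce[of "rewrite f False (emb TA f x)"] length_rewrite[of f False "emb TA f x"]
    unfolding rewrite_emb_TA[OF x(1)] by simp
  ultimately have "clen TA (other f) c \<le> 24 * clen TA f c" by (simp add: clen_def x(2))
  then show ?thesis unfolding lam_TA by linarith
qed

lemma transversal_TA: "transversal TA f"
  unfolding transversal_def
proof (intro conjI ballI)
  fix w assume "w \<in> carrier (fgroup TA f)"
  then have w: "w \<in> carrier (free_group (fgens f))" by simp
  show "\<exists>!s. s \<in> reps TA f \<and> s \<in> csub TA f #>\<^bsub>fgroup TA f\<^esub> w"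
    unfolding coset_TA[OF w]
    using coset_rep_carrier[of f] by (intro ex1I[of _ "coset_rep f (parity False w)"]) auto
next
  show "[] \<in> reps TA f" using rangeI[of "coset_rep f" False] by (simp add: coset_rep_def)
qed (use coset_rep_carrier in auto)

lemma split_rep_TA:
  assumes "h \<in> carrier (free_group (fgens f))"
  shows "split_rep TA f h = coset_rep f (parity False h)"
  using parity_machine_Some(3)[of h "fgens f" "\<lambda>q a. []" "coset_rep f True"] assms
  by (simp add: split_rep_def) (simp add: coset_rep_def)

lemma solves_coset_rep_search_TA: "solves_coset_rep_search TA f"
  unfolding solves_coset_rep_search_def
proof (intro conjI ballI)
  show "finite (dom (program (rep_alg TA f)))" by (simp add: finite_dom_parity_machine)
  fix w assume "w \<in> carrier (fgroup TA f)"
  then have w: "w \<in> carrier (free_group (fgens f))" by simp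
  then show "halts (rep_alg TA f) w" using parity_machine_Some(1)[of w "fgens f"] by simp
  show "run_output (rep_alg TA f) w \<in> reps TA f"
    using split_rep_TA[OF w] by (simp add: split_rep_def)
  show "run_output (rep_alg TA f) w \<in> csub TA f #>\<^bsub>fgroup TA f\<^esub> w"
    unfolding coset_TA[OF w] using split_rep_TA[OF w] coset_rep_carrier[of f "parity False w"]
    by (simp add: split_rep_def)
qed

lemma emb_zs_TA: "i < 3 \<Longrightarrow> emb TA f (zs TA ! i) = reduce (basis f i)"
  by (cases "i = 0"; cases "i = 1"; cases "i = 2") (auto simp: zs_TA)

text \<open>Words written by the membership machine avoid the generator z_0^12, so each index stands
  for the basis element of the same number.\<close>

lemma reduce_subst_word_TA_small:
  assumes "fst ` set c \<subseteq> {..<3}"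
  shows "reduce (subst_word TA f c) = reduce (subst (basis f) c)"
proof -
  have "subst_word TA f c = subst (\<lambda>i. reduce (basis f i)) c"
    using assms
  proof (induction c)
    case (Cons a c)
    then show ?case using emb_zs_TA[of "fst a" f] by (simp add: subst_word_Cons)
  qed (simp add: subst_word_def)
  then show ?thesis
    using reduce_subst_cong[of "\<lambda>i. reduce (basis f i)" "basis f" c] by (simp add: reduce_reduced)
qed

lemma solves_membership_search_TA: "solves_membership_search TA f"
  unfolding solves_membership_search_def
proof (intro conjI ballI impI)
  show "finite (dom (program (mem_alg TA f)))" by (simp add: finite_dom_parity_machine)
  fix w assume w: "w \<in> carrier (fgroup TA f)"
  then have m: "halts (mem_alg TA f) w" "accepts (mem_alg TA f) w \<longleftrightarrow> \<not> parity False w"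
    "run_output (mem_alg TA f) w = rewrite f False w"
    using parity_machine_None[of w "fgens f"] by simp_all
  show "halts (mem_alg TA f) w" by fact
  show "accepts (mem_alg TA f) w \<longleftrightarrow> w \<in> csub TA f" using w m(2) by (simp add: csub_TA)
  show "run_output (mem_alg TA f) w \<in> c_words TA"
    using rewrite_letters[of f False w] unfolding m(3) by (auto simp: c_words_def zs_TA)
  assume "w \<in> csub TA f"
  then show "reduce (subst_word TA f (run_output (mem_alg TA f) w)) = w"
    unfolding m(3) reduce_subst_word_TA_small[OF rewrite_letters]
    using subst_basis_rewrite[of w f False] by (simp add: csub_TA coset_rep_def reduce_reduced)
qed

lemmas TA_correct = amalgam_data_TA transversal_TA solves_membership_search_TA
  solves_coset_rep_search_TA

text \<open>The element split off is h p^-1, and p has at most one letter.\<close>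

lemma clen_split_c_TA:
  assumes h: "h \<in> carrier (free_group (fgens f))"
  shows "clen TA f (split_c TA f h) \<le> length h + 1"
proof -
  let ?p = "split_rep TA f h"
  have "reduce (subst_word TA f (split_c TA f h) @ ?p) = h"
    using split_correct(3)[OF TA_correct] h by simp
  then have "reduce (h @ inv_word ?p) = reduce (subst_word TA f (split_c TA f h) @ ?p @ inv_word ?p)"
    by (metis reduce_append_reduce(1) append_assoc)
  also have "\<dots> = reduce (subst_word TA f (split_c TA f h))"
    using reduce_cong_right[of "?p @ inv_word ?p" "[]"] by (simp add: reduce_inv_right)
  finally have "clen TA f (split_c TA f h) \<le> length (h @ inv_word ?p)"
    using length_reduce by (metis clen_def)
  then show ?thesis unfolding split_rep_TA[OF h] by (auto simp: coset_rep_def split: if_splits)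
qed

text \<open>The constant is 1 + 3: splitting \<open>h\<close> adds at most 1, and a merge splits a
  product of two representatives, a word of length at most 2, whose part in \<open>C\<close> has
  length at most 3.\<close>

lemma clen_step_TA:
  assumes "input_word TA ((f, g) # w)"
  shows "clen TA f (fst (algorithm_II TA ((f, g) # w))) \<le>
    clen TA f (fst (algorithm_II TA w)) + 4 + length g"
proof -
  obtain c ps where st: "algorithm_II TA w = (c, ps)" by (cases "algorithm_II TA w")
  have "\<forall>(f, g)\<in>set w. g \<in> carrier (fgroup TA f)"
    using assms by (fastforce simp: input_word_def simp del: TA_sel free_group_simps)
  then have nf: "normal_form TA (c, ps)"
    using algorithm_II_correct(1)[OF TA_correct, of w] by (simp only: st)
  define h p where "h = absorb TA (f, g) c" and "p = split_rep TA f h"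
  have "fst ` set (g @ subst_word TA f c) \<subseteq> fgens f"
    using assms nf subst_word_letters[OF amalgam_data_TA, of c f]
    by (simp add: input_word_def normal_form_def image_Un)
  from fst_set_reduce[OF this] have h: "h \<in> carrier (free_group (fgens f))"
    by (simp add: h_def absorb_def)
  have "length h \<le> length g + clen TA f c"
    using length_reduce[of "g @ reduce (subst_word TA f c)"]
    by (simp add: h_def absorb_def clen_def)
  then have c1: "clen TA f (split_c TA f h) \<le> clen TA f c + length g + 1"
    using clen_split_c_TA[OF h] by simp
  have step: "algorithm_II TA ((f, g) # w) = step TA (f, g) (c, ps)"
    by (simp add: algorithm_II_def flip: st[unfolded algorithm_II_def])
  show ?thesis
  proof (cases "p = [] \<or> ps = [] \<or> fst (hd ps) \<noteq> f")
    case True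
    then have "fst (step TA (f, g) (c, ps)) = split_c TA f h"
      by (auto simp: step_def Let_def simp flip: h_def p_def)
    then show ?thesis using c1 by (simp add: step st)
  next
    case False
    then obtain p1 qs where ps: "ps = (f, p1) # qs" "p \<noteq> []" by (cases ps) auto
    define h' where "h' = reduce (p @ p1)"
    have fs: "fst (step TA (f, g) (c, ps)) = split_c TA f h @ split_c TA f h'"
      using ps by (simp add: step_def Let_def h'_def flip: h_def p_def)
    obtain q q1 where q: "p = coset_rep f q" "p1 = coset_rep f q1"
      using nf ps split_rep_TA[OF h] by (auto simp: normal_form_def p_def)
    have "fst ` set (p @ p1) \<subseteq> fgens f" by (auto simp: q coset_rep_def)
    from fst_set_reduce[OF this] have h': "h' \<in> carrier (free_group (fgens f))"
      by (simp add: h'_def)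
    have "length h' \<le> 2"
      using length_reduce[of "p @ p1"] by (auto simp: q h'_def coset_rep_def split: if_splits)
    then have "clen TA f (split_c TA f h') \<le> 3" using clen_split_c_TA[OF h'] by simp
    then show ?thesis
      using c1 clen_append[of TA f "split_c TA f h" "split_c TA f h'"] by (simp add: step st fs)
  qed
qed

lemma length_coset_rep: "length (coset_rep f q) = of_bool q"
  by (simp add: coset_rep_def)

lemma standing_assumptions_TA: "standing_assumptions TA 2 4"
  unfolding standing_assumptions_def
proof (intro conjI allI impI ballI)
  fix f s w assume s: "s \<in> reps TA f" and w: "w \<in> csub TA f #>\<^bsub>fgroup TA f\<^esub> s"
  then obtain q where q: "s = coset_rep f q" by auto
  then have "parity False w = q" using w by (simp only: coset_TA[OF coset_rep_carrier]) simp
  then show "length s \<le> length w"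
    by (cases w; cases q) (auto simp: q length_coset_rep)
next
  fix f c s assume c: "c \<in> csub TA f" and s: "s \<in> reps TA f"
  then obtain q where q: "s = coset_rep f q" by auto
  have "reduce (reduce (c @ s) @ inv_word s) = c"
    using c reduce_cong_right[of "s @ inv_word s" "[]" c]
    by (simp add: reduce_inv_right csub_TA reduce_reduced)
  then have "length c \<le> length (reduce (c @ s)) + length s"
    using length_reduce[of "reduce (c @ s) @ inv_word s"] by simp
  then show "real (length c) \<le> real (length (c \<otimes>\<^bsub>fgroup TA f\<^esub> s)) + 4"
    by (cases q) (simp_all add: q length_coset_rep)
next
  fix f w assume "w \<in> carrier (fgroup TA f)"
  then have w: "fst ` set w \<subseteq> fgens f" by simp
  show "real (run_time (mem_alg TA f) w) \<le> 2 * real (length w)"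
    using parity_machine_None(2)[OF w, of "rewrite_letter f"] by simp
  \<comment> \<open>A word of odd parity is non-empty, so a letter pays for the additional step; on
    the empty input the machine halts at once, as a bound proportional to the length
    demands.\<close>
  have "of_bool (parity False w) \<le> length w" by (cases w) auto
  then have "run_time (rep_alg TA f) w \<le> 2 * length w"
    using parity_machine_Some(2)[OF w, of "\<lambda>q a. []" "coset_rep f True"] by simp
  then show "real (run_time (rep_alg TA f) w) \<le> 2 * real (length w)" by linarith
next
  fix f g w assume "input_word TA ((f, g) # w)"
  from clen_step_TA[OF this] show "real (clen TA f (fst (algorithm_II TA ((f, g) # w)))) \<le>
      real (clen TA f (fst (algorithm_II TA w))) + 4 + real (length g)" by linarith
qed (use TA_correct clen_other_TA in auto)

section \<open>Exponential growth along a family of inputs\<close>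

text \<open>The action on the exponent sums of \<open>z\<^sub>1, z\<^sub>2\<close> of conjugation by the letter \<open>s\<close> of a factor.\<close>

fun conj_expo :: "factor \<Rightarrow> int \<times> int \<Rightarrow> int \<times> int" where
  "conj_expo FA (a, b) = (b, a)"
| "conj_expo FB (a, b) = (3 * a + b, - 8 * a - 3 * b)"

definition expos :: "nat word \<Rightarrow> int \<times> int" where
  "expos w = (expo 1 w, expo 2 w)"

lemma conj_expo_add: "conj_expo f (x + y) = conj_expo f x + conj_expo f y"
  by (cases f; cases x; cases y) auto

lemma expos_append: "expos (v @ w) = expos v + expos w"
  by (simp add: expos_def)

text \<open>Rewriting an even word c from the nontrivial coset computes s c s^-1. Each basis word
  returns to that coset, so the map is additive and the generators suffice: in \<open>B\<close>, z_1
  gives (3, -8) and z_2 gives (1, -3).\<close>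

lemma expos_rewrite_subst_basis:
  assumes "fst ` set c \<subseteq> {..<3}"
  shows "expos (rewrite f True (subst (basis f) c)) = conj_expo f (expos c)"
  using assms
proof (induction c)
  case Nil
  then show ?case by (cases f) (simp_all add: expos_def)
next
  case (Cons a c)
  have "fst a = 0 \<or> fst a = 1 \<or> fst a = 2" using Cons.prems by auto
  then have "expos (rewrite f True (subst (basis f) [a])) = conj_expo f (expos [a])"
    by (cases a; cases "snd a"; cases f; auto simp: expos_def compute)
  moreover have "expos (rewrite f True (subst (basis f) c)) = conj_expo f (expos c)"
    using Cons by auto
  moreover have "rewrite f True (subst (basis f) (a # c)) =
      rewrite f True (subst (basis f) [a]) @ rewrite f True (subst (basis f) c)" by simp
  moreover have "expos (a # c) = expos [a] + expos c" by (simp add: expos_def)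
  ultimately show ?case by (simp only: expos_append conj_expo_add)
qed

text \<open>The word to be split is s c, of odd parity, so its representative is s again and the
  element passed on is s c s^-1. By the assumption on \<open>ps\<close> no merge takes
  place.\<close>

lemma step_TA:
  assumes c: "fst ` set c \<subseteq> {..<3}" and ps: "ps = [] \<or> fst (hd ps) \<noteq> f"
  obtains c' where "step TA (f, [(s_gen f, True)]) (c, ps) = (c', (f, [(s_gen f, True)]) # ps)"
    "fst ` set c' \<subseteq> {..<3}" "expos c' = conj_expo f (expos c)"
proof -
  let ?s = "[(s_gen f, True)]"
  define h where "h = absorb TA (f, ?s) c"
  have h_eq: "h = reduce (?s @ subst (basis f) c)"
    unfolding h_def absorb_def fst_conv snd_conv
    by (rule reduce_cong_right) (rule reduce_subst_word_TA_small[OF c])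
  have "fst ` set (?s @ subst (basis f) c) \<subseteq> fgens f"
    using subst_letters[OF basis_letters, of f "\<lambda>i. i" c] by simp
  from fst_set_reduce[OF this] have h: "h \<in> carrier (free_group (fgens f))" by (simp add: h_eq)
  have p: "split_rep TA f h = ?s"
    unfolding split_rep_TA[OF h] by (simp add: h_eq coset_rep_def)
  have i: "split_c_input TA f h = reduce (?s @ subst (basis f) c @ inv_word ?s)"
    unfolding split_c_input_def p by (simp add: h_eq)
  have "fst ` set (?s @ subst (basis f) c @ inv_word ?s) \<subseteq> fgens f"
    using subst_letters[OF basis_letters, of f "\<lambda>i. i" c] by (simp add: image_Un)
  from fst_set_reduce[OF this] have c': "split_c TA f h = rewrite f False (split_c_input TA f h)"
    unfolding split_c_def i using parity_machine_None(4)[of _ "fgens f" "rewrite_letter f"] by simp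
  \<comment> \<open>Exponent sums do not see reductions, so the unreduced word may be rewritten
    instead. Its first letter only switches the state to \<open>True\<close>, its last one only
    switches it back, and neither writes anything.\<close>
  have "expo j (split_c TA f h) = expo j (rewrite f True (subst (basis f) c))" for j
  proof -
    have "expo j (split_c TA f h) = expo j (reduce (rewrite f False (?s @ subst (basis f) c @ inv_word ?s)))"
      unfolding c' i by (metis expo_reduce reduce_rewrite)
    then show ?thesis by (simp add: inv_word_def inv_letter_def rewrite_letter_def rewrite_pos_def)
  qed
  then have e: "expos (split_c TA f h) = conj_expo f (expos c)"
    using expos_rewrite_subst_basis[OF c, of f] by (simp add: expos_def)
  have "step TA (f, ?s) (c, ps) = (split_c TA f h, (f, ?s) # ps)"
    using ps by (auto simp: step_def Let_def p simp flip: h_def)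
  then show thesis
    using that e rewrite_letters[of f False "split_c_input TA f h"] unfolding c' by blast
qed

text \<open>The last syllable is \<open>t\<close> in \<open>A\<close>, which equals z_1; the
  syllables before it conjugate it by s_B and s_A in turn.\<close>

fun slow_word :: "nat \<Rightarrow> nat syllable list" where
  "slow_word 0 = [(FA, [(1, True)])]"
| "slow_word (Suc n) = (FA, [(0, True)]) # (FB, [(2, True)]) # slow_word n"

lemma length_slow_word: "length (slow_word n) = 2 * n + 1"
  by (induction n) auto

lemma input_word_slow_word: "input_word TA (slow_word n)"
proof -
  have "fst (hd (slow_word n)) = FA" "slow_word n \<noteq> []" for n by (cases n; simp)+
  then show ?thesis
    by (induction n) (auto simp: input_word_def)
qed

text \<open>
  With the sign \<open>\<sigma>\<close> factored out, the exponents are \<open>(a, -b)\<close> with \<open>0 \<le> b \<le> a\<close>, and one round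
  sends \<open>(a, b)\<close> to \<open>(8a - 3b, 3a - b)\<close>.
\<close>

lemma algorithm_II_slow_word:
  "\<exists>c ps \<sigma> a b. algorithm_II TA (slow_word n) = (c, ps) \<and> (ps = [] \<or> fst (hd ps) = FA) \<and>
     fst ` set c \<subseteq> {..<3} \<and> \<sigma> \<in> {1, - 1} \<and> expos c = (\<sigma> * a, - (\<sigma> * b)) \<and>
     0 \<le> b \<and> b \<le> a \<and> 5 ^ n \<le> a"
proof (induction n)
  case 0
  have h: "absorb TA (FA, [(1, True)]) [] = [(1, True)]"
    by (simp add: absorb_def subst_word_def reduce_def push_def)
  have p: "split_rep TA FA [(1, True)] = []"
    by (subst split_rep_TA) (auto simp: coset_rep_def)
  have "split_c_input TA FA [(1, True)] = [(1, True)]"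
    unfolding split_c_input_def p by (simp add: reduce_def push_def)
  then have "split_c TA FA [(1, True)] = [(1, True)]"
    using parity_machine_None(4)[of "[(1, True)]" "{0, Suc 0}" "rewrite_letter FA"]
    by (simp add: split_c_def rewrite_letter_def rewrite_pos_def)
  then have "algorithm_II TA (slow_word 0) = ([(1, True)], [])"
    by (simp add: algorithm_II_def step_def h p del: One_nat_def)
  then show ?case
    by (intro exI[of _ "[(1, True)]"] exI[of _ "[]"] exI[of _ 1] exI[of _ 0]) (simp add: expos_def)
next
  case (Suc n)
  then obtain c ps \<sigma> a b where c: "algorithm_II TA (slow_word n) = (c, ps)"
    "ps = [] \<or> fst (hd ps) = FA" "fst ` set c \<subseteq> {..<3}" "\<sigma> \<in> {1, - 1}"
    "expos c = (\<sigma> * a, - (\<sigma> * b))" "0 \<le> b" "b \<le> a" "5 ^ n \<le> a" by blast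
  obtain c1 where c1: "step TA (FB, [(2, True)]) (c, ps) = (c1, (FB, [(2, True)]) # ps)"
    "fst ` set c1 \<subseteq> {..<3}" "expos c1 = conj_expo FB (expos c)"
    using step_TA[OF c(3), of ps FB] c(2) unfolding s_gen.simps by (metis factor.distinct(1))
  obtain c2 where c2: "step TA (FA, [(0, True)]) (c1, (FB, [(2, True)]) # ps) =
      (c2, (FA, [(0, True)]) # (FB, [(2, True)]) # ps)"
    "fst ` set c2 \<subseteq> {..<3}" "expos c2 = conj_expo FA (expos c1)"
    using step_TA[OF c1(2), of "(FB, [(2, True)]) # ps" FA] unfolding s_gen.simps
    by (metis factor.distinct(1) fst_conv list.sel(1))
  have "algorithm_II TA (slow_word (Suc n)) = (c2, (FA, [(0, True)]) # (FB, [(2, True)]) # ps)"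
    using c(1) c1(1) c2(1) by (simp add: algorithm_II_def)
  moreover have "expos c2 = (- \<sigma> * (8 * a - 3 * b), - (- \<sigma> * (3 * a - b)))"
    by (simp add: c2(3) c1(3) c(5) algebra_simps)
  \<comment> \<open>From b <= a follows 8a - 3b >= 5a, the growth factor per round.\<close>
  moreover have "- \<sigma> \<in> {1, - 1}" "0 \<le> 3 * a - b" "3 * a - b \<le> 8 * a - 3 * b"
    "5 ^ Suc n \<le> 8 * a - 3 * b"
    using c(4,6-8) by auto
  ultimately show ?case using c2(2) by (metis fst_conv list.sel(1))
qed

text \<open>The cost of (a.2) or (b.2) counts letters before reduction, and every generator of
  \<open>C\<close> has a non-empty image.\<close>

lemma length_le_step_time_TA:
  assumes "fst ` set c \<subseteq> {..<3}"
  shows "length c \<le> step_time TA s (c, ps)"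
proof -
  have "length c \<le> length (subst_word TA f c)" for f
    using assms
  proof (induction c)
    case (Cons a c)
    have "fst a = 0 \<or> fst a = 1 \<or> fst a = 2" using Cons.prems by auto
    then have "emb TA f (zs TA ! fst a) \<noteq> []"
      by (cases f) (auto simp: zs_TA compute)
    then have "1 \<le> length (emb TA f (zs TA ! fst a))" by (cases "emb TA f (zs TA ! fst a)") auto
    then show ?case using Cons by (simp add: subst_word_Cons del: TA_sel)
  qed simp
  from this[of "fst s"] show ?thesis by (simp add: step_time_def Let_def)
qed

text \<open>Already the pass for the syllable in \<open>B\<close> in front of
  \<open>slow_word n\<close> has to rewrite a word with at least 5^n letters.\<close>

lemma time_II_slow_word: "5 ^ n \<le> time_II TA (slow_word (Suc n))"
proof -
  obtain c ps \<sigma> a b where c: "algorithm_II TA (slow_word n) = (c, ps)"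
    "fst ` set c \<subseteq> {..<3}" "\<sigma> \<in> {1, - 1}" "expos c = (\<sigma> * a, - (\<sigma> * b))" "5 ^ n \<le> a"
    using algorithm_II_slow_word[of n] by blast
  have "(0::int) \<le> 5 ^ n" by simp
  then have "int (5 ^ n) \<le> \<bar>expo 1 c\<bar>" using c(3-5) by (auto simp: expos_def)
  then have "5 ^ n \<le> length c" using expo_le_length[of 1 c] by linarith
  then show ?thesis
    using length_le_step_time_TA[OF c(2), of "(FB, [(2, True)])" ps] by (simp add: c(1))
qed

lemma time_II_lower_bound:
  "\<exists>w. input_word TA w \<and> N \<le> length w \<and> real (time_II TA w) \<ge> 1 / 8 * 2 ^ length w"
proof (intro exI conjI)
  let ?w = "slow_word (Suc N)"
  show "input_word TA ?w" by (rule input_word_slow_word)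
  show "N \<le> length ?w" by (simp only: length_slow_word) simp
  \<comment> \<open>The length is 2 N + 3, so the base 2 and the constant 1 / 8 give exactly
    4^N.\<close>
  have "(1 / 8 :: real) * 2 ^ length ?w = 4 ^ N"
    by (simp only: length_slow_word) (simp add: power_mult)
  also have "\<dots> \<le> 5 ^ N" by (intro power_mono) auto
  also have "\<dots> \<le> real (time_II TA ?w)"
    using time_II_slow_word[of N] by (metis of_nat_le_iff of_nat_numeral of_nat_power)
  finally show "1 / 8 * 2 ^ length ?w \<le> real (time_II TA ?w)" .
qed

theorem theorem3p7:
  shows
    "(\<forall>(D :: ('x, 'c) amalgam) (L :: real) (M :: real).
        standing_assumptions D L M \<longrightarrow>
          (\<exists>L\<^sub>1 :: real. \<forall>w. input_word D w \<longrightarrow>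
             real (time_II D w) \<le>
               real (length w) * L\<^sub>1 * real (total_length w) * lam D ^ length w *
               (real (total_length w) + M)))
     \<and>
     (\<exists>(D :: (nat, nat word) amalgam) (L :: real) (M :: real).
        standing_assumptions D L M \<and>
        (\<exists>L\<^sub>1 :: real. \<forall>w. input_word D w \<longrightarrow>
           real (time_II D w) \<le>
             real (length w) * L\<^sub>1 * real (total_length w) * lam D ^ length w *
             (real (total_length w) + M)) \<and>
        (\<exists>(c :: real) (\<alpha> :: real). c > 0 \<and> \<alpha> > 1 \<and>
           (\<forall>N. \<exists>w. input_word D w \<and> length w \<ge> N \<and>
              real (time_II D w) \<ge> c * \<alpha> ^ length w)))"
proof (intro conjI allI impI)
  fix D :: "('x, 'c) amalgam" and L M :: real
  assume "standing_assumptions D L M"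
  then show "\<exists>L\<^sub>1 :: real. \<forall>w. input_word D w \<longrightarrow>
             real (time_II D w) \<le>
               real (length w) * L\<^sub>1 * real (total_length w) * lam D ^ length w *
               (real (total_length w) + M)"
    by (intro admissible.time_II_upper_bound admissible.intro)
next
  obtain L\<^sub>1 where L1: "\<forall>w. input_word TA w \<longrightarrow> real (time_II TA w) \<le>
      real (length w) * L\<^sub>1 * real (total_length w) * lam TA ^ length w * (real (total_length w) + 4)"
    using admissible.time_II_upper_bound[OF admissible.intro[OF standing_assumptions_TA]] by blast
  show "\<exists>(D :: (nat, nat word) amalgam) (L :: real) (M :: real).
        standing_assumptions D L M \<and>
        (\<exists>L\<^sub>1 :: real. \<forall>w. input_word D w \<longrightarrow>
           real (time_II D w) \<le>
             real (length w) * L\<^sub>1 * real (total_length w) * lam D ^ length w *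
             (real (total_length w) + M)) \<and>
        (\<exists>(c :: real) (\<alpha> :: real). c > 0 \<and> \<alpha> > 1 \<and>
           (\<forall>N. \<exists>w. input_word D w \<and> length w \<ge> N \<and>
              real (time_II D w) \<ge> c * \<alpha> ^ length w))"
  proof (intro exI conjI)
    show "standing_assumptions TA 2 4" by (rule standing_assumptions_TA)
    show "\<forall>w. input_word TA w \<longrightarrow> real (time_II TA w) \<le>
        real (length w) * L\<^sub>1 * real (total_length w) * lam TA ^ length w * (real (total_length w) + 4)"
      by (rule L1)
    show "\<forall>N. \<exists>w. input_word TA w \<and> N \<le> length w \<and> 1 / 8 * 2 ^ length w \<le> real (time_II TA w)"
      using time_II_lower_bound by blast
  qed simp_all
qed

end
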